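(* Let $\mathcal{U},\mathcal{V},\mathcal{X},\mathcal{Y}$ be finite alphabets, let $P_{UV},Q_{UV}$ be pmfs on $\mathcal{U}\times\mathcal{V}$ with $Q_{UV}(u,v)>0$ for all $(u,v)$, let $\Gamma_{Y|X}$ be the transition law of a discrete memoryless channel from $\mathcal{X}$ to $\mathcal{Y}$, and let $\{k(n)\}_{n\ge1}$ be a sequence of positive integers with $\lim_{n\to\infty}k(n)=\infty$ and $\lim_{n\to\infty}k(n)/n=0$. Let $\theta^\star_{\mathrm{sublin}}(\epsilon)$ be the Stein-exponent (defined in the context) of distributed detection of $P_{UV}$ versus $Q_{UV}$ over $k(n)$ uses of the channel. Fix $\epsilon\in[0,1)$. 1) If there exist two inputs $x_0,x_1\in\mathcal{X}$ and an output $y^*\in\mathcal{Y}$ with $\Gamma_{Y|X}(y^*|x_0)>0$ and $\Gamma_{Y|X}(y^*|x_1)=0$, then $$\theta^\star_{\mathrm{sublin}}(\epsilon)=\min_{\pi_{UV}:\ \pi_U=P_U,\ \pi_V=P_V} D(\pi_{UV}\|Q_{UV}),$$ where the minimum is over pmfs $\pi_{UV}$ on $\mathcal{U}\times\mathcal{V}$ with the indicated marginals. 2) Otherwise (if no such triple $(x_0,x_1,y^* )$ exists), $$\theta^\star_{\mathrm{sublin}}(\epsilon)=D(P_V\|Q_V).$$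
   Context: Setup. For each blocklength $n$, a sensor observes $U^n=(U_1,\dots,U_n)$ and a decision center observes $V^n=(V_1,\dots,V_n)$. Under hypothesis $\mathcal{H}=0$ the pairs $(U_i,V_i)$ are i.i.d. $\sim P_{UV}$; under $\mathcal{H}=1$ they are i.i.d. $\sim Q_{UV}$. Marginals are denoted $P_U,P_V,Q_U,Q_V$. The sensor communicates to the decision center over $k=k(n)$ uses of a discrete memoryless channel $\Gamma_{Y|X}$: an encoding function $f^{(n)}:\mathcal{U}^n\to\mathcal{X}^k$ produces $X^k=f^{(n)}(U^n)$; given $X^k=x^k$ (and whatever the values of $V^n$, $U^n$ and the hypothesis), the output $Y^k$ has pmf $\prod_{i=1}^k\Gamma_{Y|X}(y_i|x_i)$; a decision function $g^{(n)}:\mathcal{V}^n\times\mathcal{Y}^k\to\{0,1\}$ produces $\hat{\mathcal{H}}=g^{(n)}(V^n,Y^k)$. Error probabilities: $\alpha_n=\Pr[\hat{\mathcal{H}}=1\,|\,\mathcal{H}=0]$ (type-I) and $\beta_n=\Pr[\hat{\mathcal{H}}=0\,|\,\mathcal{H}=1]$ (type-II, miss-detection). For $\epsilon\in[0,1)$, an exponent $\theta>0$ is called $\epsilon$-achievable if there exists a sequence $\{(f^{(n)},g^{(n)})\}_{n\ge1}$ with $\limsup_{n\to\infty}\alpha_n\le\epsilon$ and $\liminf_{n\to\infty}-\frac1n\log\beta_n\ge\theta$. The Stein-exponent $\theta^\star_{\mathrm{sublin}}(\epsilon)$ is the supremum of all $\epsilon$-achievable exponents $\theta$, with the supremum of the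 empty set taken to be $0$. $D(\cdot\|\cdot)$ is the Kullback–Leibler divergence, with the same logarithm base throughout. *)

theory Defs
  imports "HOL-Probability.Probability"
begin

text \<open>
  \<open>KL_divergence b M N\<close> is \<open>D(N || M)\<close>: the library takes the reference measure first.
\<close>
definition kl :: "real \<Rightarrow> 'a pmf \<Rightarrow> 'a pmf \<Rightarrow> real" where
  "kl b p q = KL_divergence b (measure_pmf q) (measure_pmf p)"

datatype hyp = H0 | H1

text \<open>
  A block of \<open>n\<close> symbols is a function on \<open>nat\<close> of which only the values on \<open>{..<n}\<close> matter:
  \<open>Pi_pmf {..<n}\<close> fixes all other values to a constant, so an encoder or a decision function
  applied to such a block is in effect a function of \<open>n\<close> symbols. Likewise only the first \<open>k\<close>
  symbols that the encoder outputs are sent over the channel.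
\<close>
type_synonym ('u, 'x) encoder = "(nat \<Rightarrow> 'u) \<Rightarrow> (nat \<Rightarrow> 'x)"
type_synonym ('v, 'y) decider = "(nat \<Rightarrow> 'v) \<Rightarrow> (nat \<Rightarrow> 'y) \<Rightarrow> hyp"

definition dmc :: "('x \<Rightarrow> 'y pmf) \<Rightarrow> nat \<Rightarrow> (nat \<Rightarrow> 'x) \<Rightarrow> (nat \<Rightarrow> 'y) pmf" where
  "dmc \<Gamma> k x = Pi_pmf {..<k} undefined (\<lambda>i. \<Gamma> (x i))"

text \<open>The law of the decision when the source pairs are i.i.d. with law \<open>R\<close>.\<close>
definition decision_pmf ::
  "('u \<times> 'v) pmf \<Rightarrow> ('x \<Rightarrow> 'y pmf) \<Rightarrow> nat \<Rightarrow> nat \<Rightarrow> ('u, 'x) encoder \<Rightarrow> ('v, 'y) decider \<Rightarrow> hyp pmf"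
  where
  "decision_pmf R \<Gamma> n k f g =
     bind_pmf (Pi_pmf {..<n} undefined (\<lambda>_. R)) (\<lambda>w.
     bind_pmf (dmc \<Gamma> k (f (\<lambda>i. fst (w i)))) (\<lambda>y.
     return_pmf (g (\<lambda>i. snd (w i)) y)))"

definition type1_error ::
  "('u \<times> 'v) pmf \<Rightarrow> ('x \<Rightarrow> 'y pmf) \<Rightarrow> nat \<Rightarrow> nat \<Rightarrow> ('u, 'x) encoder \<Rightarrow> ('v, 'y) decider \<Rightarrow> real"
  where "type1_error P \<Gamma> n k f g = pmf (decision_pmf P \<Gamma> n k f g) H1"

definition type2_error ::
  "('u \<times> 'v) pmf \<Rightarrow> ('x \<Rightarrow> 'y pmf) \<Rightarrow> nat \<Rightarrow> nat \<Rightarrow> ('u, 'x) encoder \<Rightarrow> ('v, 'y) decider \<Rightarrow> real"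
  where "type2_error Q \<Gamma> n k f g = pmf (decision_pmf Q \<Gamma> n k f g) H0"

text \<open>
  The rate \<open>-(1/n) log \<beta>\<close> is infinite for \<open>\<beta> = 0\<close>, whereas \<open>log b 0 = 0\<close> in the library.
\<close>
definition error_exponent :: "real \<Rightarrow> nat \<Rightarrow> real \<Rightarrow> ereal" where
  "error_exponent b n \<beta> = (if \<beta> = 0 then \<infinity> else ereal (- (1 / real n) * log b \<beta>))"

definition achievable ::
  "real \<Rightarrow> ('u \<times> 'v) pmf \<Rightarrow> ('u \<times> 'v) pmf \<Rightarrow> ('x \<Rightarrow> 'y pmf) \<Rightarrow> (nat \<Rightarrow> nat) \<Rightarrow> real \<Rightarrow> real \<Rightarrow> bool"
  where
  "achievable b P Q \<Gamma> k \<epsilon> \<theta> \<longleftrightarrow>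
     (\<exists>(f :: nat \<Rightarrow> ('u, 'x) encoder) (g :: nat \<Rightarrow> ('v, 'y) decider).
        limsup (\<lambda>n. ereal (type1_error P \<Gamma> n (k n) (f n) (g n))) \<le> ereal \<epsilon> \<and>
        liminf (\<lambda>n. error_exponent b n (type2_error Q \<Gamma> n (k n) (f n) (g n))) \<ge> ereal \<theta>)"

text \<open>
  The supremum is taken in \<open>ereal\<close>, where it is meaningful also for an unbounded set; there
  the supremum of the empty set would be \<open>-\<infinity>\<close>, hence the case distinction.
\<close>
definition stein_exponent ::
  "real \<Rightarrow> ('u \<times> 'v) pmf \<Rightarrow> ('u \<times> 'v) pmf \<Rightarrow> ('x \<Rightarrow> 'y pmf) \<Rightarrow> (nat \<Rightarrow> nat) \<Rightarrow> real \<Rightarrow> ereal"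
  where
  "stein_exponent b P Q \<Gamma> k \<epsilon> =
     (let A = {\<theta> :: real. \<theta> > 0 \<and> achievable b P Q \<Gamma> k \<epsilon> \<theta>}
      in if A = {} then 0 else (SUP \<theta>\<in>A. ereal \<theta>))"

definition couplings :: "'u pmf \<Rightarrow> 'v pmf \<Rightarrow> ('u \<times> 'v) pmf set" where
  "couplings p q = {\<pi>. map_pmf fst \<pi> = p \<and> map_pmf snd \<pi> = q}"

lemma kl_finite:
  fixes p q :: "'a :: finite pmf"
  assumes "1 < b" and pos: "\<And>a. 0 < pmf q a"
  shows "kl b p q = (\<Sum>a\<in>UNIV. pmf p a * log b (pmf p a / pmf q a))"
proof -
  interpret sigma_finite_measure "count_space (UNIV :: 'a set)"
    by (rule sigma_finite_measure_count_space_finite) simp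
  have "kl b p q = (\<integral>a. pmf p a * log b (pmf p a / pmf q a) \<partial>count_space UNIV)"
    unfolding kl_def measure_pmf_eq_density
    using pos by (intro KL_density_density)
      (auto simp: assms(1) less_imp_neq[THEN not_sym])
  then show ?thesis
    by (simp add: lebesgue_integral_count_space_finite)
qed

end

theory Submission
  imports Defs "HOL-Real_Asymp.Real_Asymp"
begin

text \<open>
  Converse: if \<open>\<pi>\<close> has marginals \<open>\<pi>\<^sub>U, \<pi>\<^sub>V\<close>, then for every \<open>\<delta> > 0\<close> there is a small \<open>s > 0\<close> such that
  \<open>E\<^sub>Q F(U) G(V) \<ge> exp (- D(\<pi>||Q) - \<delta>) \<parallel>F\<parallel>\<^sub>s \<parallel>G\<parallel>\<^sub>s\<close> for all \<open>F, G \<ge> 0\<close>, with the \<open>s\<close>-norms taken under \<open>\<pi>\<^sub>U\<close> and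
  \<open>\<pi>\<^sub>V\<close>. This inequality tensorises, and so takes the place of the blowing-up lemma: a fixed channel output
  \<open>y\<close> has probability \<open>F(U\<^sup>n)\<close> and is accepted on the event \<open>G(V\<^sup>n) = 1\<close>; as there are only \<open>exp (o(n))\<close>
  outputs, for one of them the norms are \<open>exp (o(n))\<close>, whatever \<open>\<epsilon> < 1\<close> is. If all inputs reach the same
  outputs, then \<open>F\<close> is constant up to a factor \<open>exp (o(n))\<close>, so that \<open>\<pi>\<^sub>U\<close> is arbitrary and one may take
  \<open>\<pi> = P\<^sub>V Q\<^bsub>U|V\<^esub>\<close>.

  Achievability: the minimiser has the form \<open>\<pi>(u, v) = Q(u, v) A(u) B(v)\<close>. The sensor and the decision
  center test whether \<open>\<Prod> A(U\<^sub>i)\<close> and \<open>\<Prod> B(V\<^sub>i)\<close> are at least about their typical values under \<open>P\<close>, and Markov's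
  inequality bounds the probability of both events under \<open>Q\<close>. The sensor sends its verdict by
  repeating \<open>x\<^sub>0\<close> or \<open>x\<^sub>1\<close>; the second never produces the output \<open>y\<^sup>*\<close>.
\<close>

section \<open>Relative entropy and product distributions\<close>

abbreviation iid :: "nat \<Rightarrow> 'a \<Rightarrow> 'a pmf \<Rightarrow> (nat \<Rightarrow> 'a) pmf" where
  "iid n d p \<equiv> Pi_pmf {..<n} d (\<lambda>_. p)"

text \<open>Divergence in nats. \<open>kl b\<close> is this divided by \<open>ln b\<close>, so all
  estimates can be made with \<open>ln\<close> and \<open>exp\<close> and the base enters only at
  the end.\<close>

definition relent :: "'a::finite pmf \<Rightarrow> 'a pmf \<Rightarrow> real" where
  "relent p q = (\<Sum>a\<in>UNIV. pmf p a * ln (pmf p a / pmf q a))"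

lemma kl_eq_relent:
  fixes p q :: "'a::finite pmf"
  assumes "1 < b" "\<And>a. 0 < pmf q a"
  shows "kl b p q = relent p q / ln b"
  by (simp add: kl_finite[OF assms] relent_def log_def sum_divide_distrib)

lemma sum_UNIV_prod: "(\<Sum>i\<in>(UNIV :: ('a::finite \<times> 'b::finite) set). f i) = (\<Sum>u\<in>UNIV. \<Sum>v\<in>UNIV. f (u, v))"
  by (simp add: sum.cartesian_product flip: UNIV_Times_UNIV)

lemma expectation_finite:
  fixes p :: "'a::finite pmf" and f :: "'a \<Rightarrow> real"
  shows "measure_pmf.expectation p f = (\<Sum>a\<in>UNIV. pmf p a * f a)"
  by (subst integral_measure_pmf[of UNIV]) auto

lemma sum_pmf_UNIV: "(\<Sum>a\<in>UNIV. pmf (p :: 'a::finite pmf) a) = 1"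
  by (rule sum_pmf_eq_1) auto

lemma sum_map_pmf:
  fixes p :: "'a::finite pmf" and f :: "'a \<Rightarrow> 'b::finite" and h :: "'b \<Rightarrow> real"
  shows "(\<Sum>b\<in>UNIV. pmf (map_pmf f p) b * h b) = (\<Sum>a\<in>UNIV. pmf p a * h (f a))"
  by (simp flip: expectation_finite)

lemma finite_set_iid [simp]: "finite (set_pmf (iid n d (p :: 'a::finite pmf)))"
  by (subst set_Pi_pmf) (auto intro!: finite_PiE_dflt)

lemma integrable_iid [simp]: "integrable (iid n d (p :: 'a::finite pmf)) (f :: _ \<Rightarrow> real)"
  by (rule integrable_measure_pmf_finite) simp

text \<open>Splitting off the last coordinate is the recursion behind the induction that tensorises
  the inequality.\<close>

lemma expectation_iid_Suc:
  fixes p :: "'a::finite pmf" and F :: "(nat \<Rightarrow> 'a) \<Rightarrow> real"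
  shows "measure_pmf.expectation (iid (Suc n) d p) F =
    (\<Sum>a\<in>UNIV. pmf p a * measure_pmf.expectation (iid n d p) (\<lambda>w. F (w(n := a))))"
proof -
  have "iid (Suc n) d p = p \<bind> (\<lambda>a. map_pmf (\<lambda>w. w(n := a)) (iid n d p))"
    by (simp add: lessThan_Suc Pi_pmf_insert' map_pmf_def)
  then show ?thesis
    by (simp add: pmf_expectation_bind[of UNIV])
qed

lemma expectation_iid_prod:
  fixes p :: "'a::finite pmf" and h :: "'a \<Rightarrow> real"
  assumes "\<And>a. 0 \<le> h a"
  shows "measure_pmf.expectation (iid n d p) (\<lambda>w. \<Prod>i<n. h (w i)) = (\<Sum>a\<in>UNIV. pmf p a * h a) ^ n"
  by (subst expectation_prod_Pi_pmf) (auto simp: assms expectation_finite integrable_measure_pmf_finite)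

text \<open>The default value outside the block is mapped as well, which is why the marginal blocks
  of a source with default \<open>undefined\<close> appear below with defaults
  \<open>fst undefined\<close> and \<open>snd undefined\<close>.\<close>

lemma map_iid: "map_pmf (\<lambda>w i. f (w i)) (iid n d p) = iid n (f d) (map_pmf f p)"
  by (subst Pi_pmf_map[of _ f d]) (auto simp: comp_def[abs_def])

section \<open>A reverse Brascamp--Lieb inequality\<close>

text \<open>For \<open>s \<rightarrow> 0\<close>, a function with \<open>E F\<^sup>s = 1\<close> that is bounded above is also bounded below, uniformly, and
  \<open>ln (F\<^sup>s) = F\<^sup>s - 1 + O(s\<^sup>2)\<close>.\<close>
lemma expectation_ln_lower_bound:
  fixes p :: "'a::finite pmf"
  assumes "0 < L" "0 < \<eta>"
  shows "\<forall>\<^sub>F s in at_right 0. \<forall>F. (\<forall>a. 0 \<le> F a \<and> F a \<le> exp L) \<longrightarrow> (\<Sum>a\<in>UNIV. pmf p a * F a powr s) = 1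
     \<longrightarrow> (\<forall>a. 0 < pmf p a \<longrightarrow> 0 < F a) \<and> - \<eta> \<le> (\<Sum>a\<in>UNIV. pmf p a * ln (F a))"
proof -
  define m where "m = Min (pmf p ` set_pmf p)"
  have fin: "finite (pmf p ` set_pmf p)" by simp
  have m0: "0 < m"
    unfolding m_def using fin by (subst Min_gr_iff) (auto simp: set_pmf_not_empty pmf_positive)
  have m: "m \<le> pmf p a" if "0 < pmf p a" for a
    unfolding m_def using fin that by (intro Min_le) (auto simp: set_pmf_iff)
  have m1: "m \<le> 1"
    by (metis m pmf_le_1 order_trans pmf_positive set_pmf_not_empty ex_in_conv)
  \<comment> \<open>Bounds the deviation of \<open>F a powr s\<close> from 1 on the support. Upwards
    it is at most \<open>exp (s * L) - 1\<close>; as the mean is 1, a shortfall at one atom is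
    balanced by the excess elsewhere, which costs the inverse of the atom's mass, at most
    \<open>1 / m\<close>. Hence \<open>\<kappa> s\<close> is O(s).\<close>
  define \<kappa> where "\<kappa> s = (exp (s * L) - 1) / m" for s
  have "(\<kappa> \<longlongrightarrow> 0) (at_right 0)"
    unfolding \<kappa>_def using assms m0 by real_asymp
  then have e1: "\<forall>\<^sub>F s in at_right 0. \<kappa> s < 1/2"
    by (rule order_tendstoD) simp
  have "((\<lambda>s. 2 * (\<kappa> s)\<^sup>2 / s) \<longlongrightarrow> 0) (at_right 0)"
    unfolding \<kappa>_def using assms m0 by real_asymp
  then have e2: "\<forall>\<^sub>F s in at_right 0. 2 * (\<kappa> s)\<^sup>2 / s < \<eta>"
    by (rule order_tendstoD) fact
  have e3: "\<forall>\<^sub>F s in at_right (0::real). 0 < s"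
    by (simp add: eventually_at_right_less)
  show ?thesis
    using e1 e2 e3
  proof (eventually_elim, intro allI impI)
    fix s F assume k: "\<kappa> s < 1/2" and k2: "2 * (\<kappa> s)\<^sup>2 / s < \<eta>" and s: "0 < (s::real)"
      and F: "\<forall>a. 0 \<le> F a \<and> F a \<le> exp L" and E: "(\<Sum>a\<in>UNIV. pmf p a * F a powr s) = 1"
    have up: "F a powr s \<le> exp (s * L)" for a
      using powr_mono2[of s "F a" "exp L"] F s by (simp add: powr_def)
    have eL: "1 \<le> exp (s * L)" using s assms by simp
    have b: "\<bar>F a powr s - 1\<bar> \<le> \<kappa> s" if a: "0 < pmf p a" for a
    proof -
      have "1 = pmf p a * F a powr s + (\<Sum>c\<in>UNIV - {a}. pmf p c * F c powr s)"
        by (subst E[symmetric], rule sum.remove) auto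
      also have "(\<Sum>c\<in>UNIV - {a}. pmf p c * F c powr s) \<le> (\<Sum>c\<in>UNIV - {a}. pmf p c * exp (s * L))"
        by (intro sum_mono mult_left_mono up) auto
      also have "(\<Sum>c\<in>UNIV - {a}. pmf p c * exp (s * L)) = (1 - pmf p a) * exp (s * L)"
        using sum.remove[of UNIV a "pmf p"] by (simp add: sum_pmf_UNIV flip: sum_distrib_right)
      finally have "pmf p a * (1 - F a powr s) \<le> (1 - pmf p a) * (exp (s * L) - 1)"
        by (simp add: algebra_simps)
      also have "\<dots> \<le> 1 * (exp (s * L) - 1)"
        using eL by (intro mult_right_mono) auto
      finally have "1 - F a powr s \<le> (exp (s * L) - 1) / pmf p a"
        using a by (simp add: field_simps)
      also have "\<dots> \<le> \<kappa> s"
        unfolding \<kappa>_def using m[OF a] m0 eL a by (intro divide_left_mono) auto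
      finally have l: "1 - F a powr s \<le> \<kappa> s" .
      have "F a powr s - 1 \<le> exp (s * L) - 1" using up by simp
      also have "\<dots> \<le> \<kappa> s"
        unfolding \<kappa>_def using m0 m1 eL by (subst le_divide_eq) (auto intro: mult_left_le)
      finally show ?thesis using l by simp
    qed
    have pos: "0 < F a" if a: "0 < pmf p a" for a
    proof (rule ccontr)
      assume "\<not> 0 < F a"
      with F have "F a = 0" by (meson not_le antisym)
      with b[OF a] k s show False by simp
    qed
    have ln: "pmf p a * (F a powr s - 1) - pmf p a * (2 * (\<kappa> s)\<^sup>2) \<le> pmf p a * (s * ln (F a))" for a
    proof (cases "pmf p a = 0")
      case False
      then have a: "0 < pmf p a" by (simp add: pmf_pos)
      have "\<bar>ln (1 + (F a powr s - 1)) - (F a powr s - 1)\<bar> \<le> 2 * (F a powr s - 1)\<^sup>2"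
        using b[OF a] k by (intro abs_ln_one_plus_x_minus_x_bound) auto
      moreover have "(F a powr s - 1)\<^sup>2 \<le> (\<kappa> s)\<^sup>2"
        using power_mono[OF b[OF a], of 2] by simp
      moreover have "ln (F a powr s) = s * ln (F a)"
        using pos[OF a] by (simp add: ln_powr)
      ultimately have "(F a powr s - 1) - 2 * (\<kappa> s)\<^sup>2 \<le> s * ln (F a)" by simp
      from mult_left_mono[OF this, of "pmf p a"] show ?thesis by (simp add: algebra_simps)
    qed simp
    \<comment> \<open>The first-order terms average to zero by normalisation. Only the quadratic
      remainder is left, and it is o(s), so it survives division by \<open>s\<close>.\<close>
    have "- 2 * (\<kappa> s)\<^sup>2 = (\<Sum>a\<in>UNIV. pmf p a * (F a powr s - 1) - pmf p a * (2 * (\<kappa> s)\<^sup>2))"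
      by (simp add: sum_subtractf right_diff_distrib E sum_pmf_UNIV flip: sum_distrib_right)
    also have "\<dots> \<le> (\<Sum>a\<in>UNIV. pmf p a * (s * ln (F a)))"
      by (intro sum_mono ln)
    also have "\<dots> = s * (\<Sum>a\<in>UNIV. pmf p a * ln (F a))"
      by (simp add: sum_distrib_left algebra_simps)
    finally have "- (2 * (\<kappa> s)\<^sup>2 / s) \<le> (\<Sum>a\<in>UNIV. pmf p a * ln (F a))"
      using s by (simp add: field_simps)
    with k2 pos show "(\<forall>a. 0 < pmf p a \<longrightarrow> 0 < F a) \<and> - \<eta> \<le> (\<Sum>a\<in>UNIV. pmf p a * ln (F a))"
      by auto
  qed
qed

text \<open>The Gibbs variational inequality for a nonnegative weight \<open>q\<close>: apply
  \<open>ln x \<le> x - 1\<close> to the ratio of the normalised weight \<open>q a * F a / S\<close>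
  to \<open>pmf p a\<close> and average under \<open>p\<close>.\<close>

lemma sum_ge_exp_relent:
  fixes p :: "'a::finite pmf" and q F :: "'a \<Rightarrow> real"
  assumes nn: "\<And>a. 0 \<le> q a" "\<And>a. 0 \<le> F a"
    and pos: "\<And>a. 0 < pmf p a \<Longrightarrow> 0 < q a \<and> 0 < F a"
  shows "exp ((\<Sum>a\<in>UNIV. pmf p a * ln (F a)) - (\<Sum>a\<in>UNIV. pmf p a * ln (pmf p a / q a)))
     \<le> (\<Sum>a\<in>UNIV. q a * F a)"
proof -
  define S where "S = (\<Sum>a\<in>UNIV. q a * F a)"
  obtain a0 where "0 < pmf p a0"
    by (metis pmf_positive set_pmf_not_empty ex_in_conv)
  then have "0 < q a0 * F a0" using pos by auto
  also have "q a0 * F a0 \<le> S"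
    unfolding S_def by (intro member_le_sum) (auto simp: nn)
  finally have S: "0 < S" .
  have "pmf p a * ln (F a) - pmf p a * ln (pmf p a / q a) - pmf p a * ln S \<le> q a * F a / S - pmf p a" for a
  proof (cases "pmf p a = 0")
    case True
    then show ?thesis using nn S by simp
  next
    case False
    then have p: "0 < pmf p a" by (simp add: pmf_pos)
    with pos have qF: "0 < q a" "0 < F a" by auto
    have "ln (q a * F a / (S * pmf p a)) \<le> q a * F a / (S * pmf p a) - 1"
      using p qF S by (intro ln_le_minus_one) auto
    then have "pmf p a * ln (q a * F a / (S * pmf p a)) \<le> pmf p a * (q a * F a / (S * pmf p a) - 1)"
      using p by (intro mult_left_mono) auto
    also have "\<dots> = q a * F a / S - pmf p a"
      using p S by (simp add: field_simps)
    finally show ?thesis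
      using p qF S by (simp add: ln_div ln_mult algebra_simps)
  qed
  then have "(\<Sum>a\<in>UNIV. pmf p a * ln (F a) - pmf p a * ln (pmf p a / q a) - pmf p a * ln S)
      \<le> (\<Sum>a\<in>UNIV. q a * F a / S - pmf p a)"
    by (intro sum_mono)
  also have "\<dots> = 0"
    using S by (simp add: sum_subtractf sum_pmf_UNIV S_def flip: sum_divide_distrib)
  finally have "(\<Sum>a\<in>UNIV. pmf p a * ln (F a)) - (\<Sum>a\<in>UNIV. pmf p a * ln (pmf p a / q a)) \<le> ln S"
    by (simp add: sum_subtractf sum_pmf_UNIV flip: sum_distrib_right)
  then show ?thesis
    using S unfolding S_def by (subst (asm) ln_ge_iff) auto
qed

lemma relent_nonneg:
  fixes p q :: "'a::finite pmf"
  assumes "\<And>a. 0 < pmf q a"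
  shows "0 \<le> relent p q"
  using sum_ge_exp_relent[of "pmf q" "\<lambda>_. 1" p] assms by (simp add: sum_pmf_UNIV relent_def)

text \<open>If \<open>F\<close> and \<open>G\<close> are normalised, either one of them has a large value, and the right-hand side is
  large because \<open>Q\<close> has full support, or \<open>E ln F\<close> and \<open>E ln G\<close> are nearly nonnegative for small \<open>s\<close>.\<close>
lemma reverse_Brascamp_Lieb:
  fixes Q \<pi> :: "('u::finite \<times> 'v::finite) pmf"
  assumes Q: "\<And>u v. 0 < pmf Q (u, v)" and "0 < \<delta>"
  shows "\<exists>s. 0 < s \<and> s \<le> 1 \<and> (\<forall>F G. (\<forall>u. 0 \<le> F u) \<longrightarrow> (\<forall>v. 0 \<le> G v) \<longrightarrow>
    exp (- (relent \<pi> Q + \<delta>))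
      * (\<Sum>u\<in>UNIV. pmf (map_pmf fst \<pi>) u * F u powr s) powr (1 / s)
      * (\<Sum>v\<in>UNIV. pmf (map_pmf snd \<pi>) v * G v powr s) powr (1 / s)
    \<le> (\<Sum>(u, v)\<in>UNIV. pmf Q (u, v) * (F u * G v)))"
proof -
  let ?pU = "map_pmf fst \<pi>" and ?pV = "map_pmf snd \<pi>"
  define m where "m = Min (range (pmf Q))"
  have m0: "0 < m" unfolding m_def using Q by (subst Min_gr_iff) auto
  have m: "m \<le> pmf Q i" for i unfolding m_def by (intro Min_le) auto
  have m1: "m \<le> 1" by (rule order_trans[OF m pmf_le_1])
  \<comment> \<open>Chosen so that a single cell with \<open>F u * G v \<ge> exp L\<close> already
    contributes at least \<open>m * exp L \<ge> 1\<close> to the sum, which exceeds the claimed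
    bound.\<close>
  define L where "L = 1 - ln m"
  have L: "0 < L" using ln_le_minus_one[OF m0] m1 by (simp add: L_def)
  have mL: "1 \<le> m * exp L"
    using m0 by (simp add: L_def exp_diff)
  have d2: "0 < \<delta> / 2" using \<open>0 < \<delta>\<close> by simp
  have "\<forall>\<^sub>F s in at_right (0::real). s < 1"
    by (rule eventually_at_rightI[of 0 1]) auto
  from eventually_happens[OF eventually_conj[OF eventually_conj[OF
      expectation_ln_lower_bound[OF L d2, of ?pU] expectation_ln_lower_bound[OF L d2, of ?pV]]
      eventually_conj[OF this eventually_at_right_less]]]
  obtain s where s: "0 < s" "s < 1"
    and bU: "\<And>F. (\<And>a. 0 \<le> F a \<and> F a \<le> exp L) \<Longrightarrow> (\<Sum>a\<in>UNIV. pmf ?pU a * F a powr s) = 1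
        \<Longrightarrow> (\<forall>a. 0 < pmf ?pU a \<longrightarrow> 0 < F a) \<and> - (\<delta> / 2) \<le> (\<Sum>a\<in>UNIV. pmf ?pU a * ln (F a))"
    and bV: "\<And>F. (\<And>a. 0 \<le> F a \<and> F a \<le> exp L) \<Longrightarrow> (\<Sum>a\<in>UNIV. pmf ?pV a * F a powr s) = 1
        \<Longrightarrow> (\<forall>a. 0 < pmf ?pV a \<longrightarrow> 0 < F a) \<and> - (\<delta> / 2) \<le> (\<Sum>a\<in>UNIV. pmf ?pV a * ln (F a))"
    by auto
  have D: "0 \<le> relent \<pi> Q" using Q by (intro relent_nonneg) auto
  \<comment> \<open>If one function is very large somewhere, the other is at least 1 somewhere, and
    the two places together form a cell with a large product.\<close>
  have ex_ge_1: "\<exists>a. 1 \<le> F a" if "\<And>a. 0 \<le> F a" "(\<Sum>a\<in>UNIV. pmf p a * F a powr s) = 1"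
    for p :: "'c::finite pmf" and F
  proof (rule ccontr)
    assume "\<not> ?thesis"
    then have lt: "F a < 1" for a by (simp add: not_le)
    have *: "F a powr s < 1" for a
      using powr_less_mono2[OF s(1) that(1) lt] by simp
    obtain a0 where "0 < pmf p a0"
      by (metis pmf_positive set_pmf_not_empty ex_in_conv)
    then have "(\<Sum>a\<in>UNIV. pmf p a * F a powr s) < (\<Sum>a\<in>UNIV. pmf p a * 1)"
      using * by (intro sum_strict_mono_ex1 ballI bexI[of _ a0] mult_left_mono mult_strict_left_mono)
        (auto intro: less_imp_le)
    then show False using that by (simp add: sum_pmf_UNIV)
  qed
  have normalised: "exp (- (relent \<pi> Q + \<delta>)) \<le> (\<Sum>(u, v)\<in>UNIV. pmf Q (u, v) * (F u * G v))"
    if F: "\<And>u. 0 \<le> F u" and G: "\<And>v. 0 \<le> G v"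
      and EF: "(\<Sum>u\<in>UNIV. pmf ?pU u * F u powr s) = 1"
      and EG: "(\<Sum>v\<in>UNIV. pmf ?pV v * G v powr s) = 1" for F G
  proof -
    let ?S = "\<Sum>(u, v)\<in>UNIV. pmf Q (u, v) * (F u * G v)"
    have term_le: "pmf Q (u, v) * (F u * G v) \<le> ?S" for u v
      using member_le_sum[of "(u, v)" UNIV "\<lambda>(u, v). pmf Q (u, v) * (F u * G v)"] F G by auto
    have e1: "exp (- (relent \<pi> Q + \<delta>)) \<le> 1" using D \<open>0 < \<delta>\<close> by simp
    have large: "exp (- (relent \<pi> Q + \<delta>)) \<le> ?S" if "exp L \<le> F u * G v" for u v
    proof -
      have "m * exp L \<le> pmf Q (u, v) * (F u * G v)"
        using that m m0 F G by (intro mult_mono) auto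
      then show ?thesis using term_le[of u v] e1 mL by linarith
    qed
    obtain u0 where u0: "1 \<le> F u0" using ex_ge_1[OF F EF] by blast
    obtain v0 where v0: "1 \<le> G v0" using ex_ge_1[OF G EG] by blast
    consider u where "exp L < F u" | v where "exp L < G v"
      | "\<And>u. F u \<le> exp L" "\<And>v. G v \<le> exp L" by (meson not_le)
    then show ?thesis
    proof cases
      case 1
      then show ?thesis using v0 mult_mono[of "exp L" "F u" 1 "G v0"] F
        by (intro large[of u v0]) auto
    next
      case 2
      then show ?thesis using u0 mult_mono[of 1 "F u0" "exp L" "G v"] F
        by (intro large[of u0 v]) auto
    next
      case 3
      have U: "\<And>u. 0 < pmf ?pU u \<Longrightarrow> 0 < F u" "- (\<delta> / 2) \<le> (\<Sum>a\<in>UNIV. pmf ?pU a * ln (F a))"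
        using bU[OF _ EF] F 3 by auto
      have V: "\<And>v. 0 < pmf ?pV v \<Longrightarrow> 0 < G v" "- (\<delta> / 2) \<le> (\<Sum>a\<in>UNIV. pmf ?pV a * ln (G a))"
        using bV[OF _ EG] G 3 by auto
      have supp: "0 < F (fst i) \<and> 0 < G (snd i)" if "0 < pmf \<pi> i" for i
      proof -
        have "fst i \<in> set_pmf ?pU" "snd i \<in> set_pmf ?pV"
          using that by (auto simp: set_pmf_iff)
        then show ?thesis using U V by (auto simp: pmf_positive)
      qed
      \<comment> \<open>The logarithm of the product splits, so its mean under \<open>\<pi>\<close>
        depends on the two marginals alone, and each of them loses at most
        \<open>\<delta> / 2\<close>.\<close>
      have "(\<Sum>i\<in>UNIV. pmf \<pi> i * ln (F (fst i) * G (snd i)))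
          = (\<Sum>i\<in>UNIV. pmf \<pi> i * ln (F (fst i))) + (\<Sum>i\<in>UNIV. pmf \<pi> i * ln (G (snd i)))"
        unfolding sum.distrib[symmetric]
      proof (intro sum.cong refl)
        fix i show "pmf \<pi> i * ln (F (fst i) * G (snd i)) = pmf \<pi> i * ln (F (fst i)) + pmf \<pi> i * ln (G (snd i))"
          using supp[of i] by (cases "pmf \<pi> i = 0") (auto simp: pmf_pos ln_mult algebra_simps)
      qed
      also have "\<dots> \<ge> - \<delta>"
        using U(2) V(2) by (simp add: sum_map_pmf)
      finally have "- (relent \<pi> Q + \<delta>) \<le> (\<Sum>i\<in>UNIV. pmf \<pi> i * ln (F (fst i) * G (snd i))) - relent \<pi> Q"
        by simp
      then have "exp (- (relent \<pi> Q + \<delta>)) \<le> exp \<dots>" by simp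
      also have "\<dots> \<le> (\<Sum>i\<in>UNIV. pmf Q i * (F (fst i) * G (snd i)))"
        unfolding relent_def using Q F G supp by (intro sum_ge_exp_relent) auto
      finally show ?thesis by (simp add: case_prod_beta)
    qed
  qed
  have "exp (- (relent \<pi> Q + \<delta>))
      * (\<Sum>u\<in>UNIV. pmf ?pU u * F u powr s) powr (1 / s)
      * (\<Sum>v\<in>UNIV. pmf ?pV v * G v powr s) powr (1 / s)
    \<le> (\<Sum>(u, v)\<in>UNIV. pmf Q (u, v) * (F u * G v))"
    if F: "\<And>u. 0 \<le> F u" and G: "\<And>v. 0 \<le> G v" for F G
  proof -
    \<comment> \<open>Both sides are homogeneous of degree 1 in \<open>F\<close> and in
      \<open>G\<close>: dividing by the norms \<open>M\<close> and \<open>N\<close> reduces to the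
      normalised case, and a vanishing norm makes the left side 0.\<close>
    define a where "a = (\<Sum>u\<in>UNIV. pmf ?pU u * F u powr s)"
    define c where "c = (\<Sum>v\<in>UNIV. pmf ?pV v * G v powr s)"
    define M where "M = a powr (1 / s)"
    define N where "N = c powr (1 / s)"
    have ac: "0 \<le> a" "0 \<le> c" unfolding a_def c_def by (auto intro!: sum_nonneg)
    show ?thesis
    proof (cases "a = 0 \<or> c = 0")
      case True
      then show ?thesis
        using F G by (auto simp flip: a_def c_def intro!: sum_nonneg)
    next
      case False
      then have pos: "0 < a" "0 < c" "0 < M" "0 < N" using ac by (auto simp: M_def N_def)
      have *: "M powr s = a" "N powr s = c"
        using s pos by (auto simp: M_def N_def powr_powr)
      have "exp (- (relent \<pi> Q + \<delta>)) \<le> (\<Sum>(u, v)\<in>UNIV. pmf Q (u, v) * (F u / M * (G v / N)))"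
      proof (rule normalised)
        show "(\<Sum>u\<in>UNIV. pmf ?pU u * (F u / M) powr s) = 1"
          using pos F by (simp add: powr_divide * flip: sum_divide_distrib) (simp add: a_def)
        show "(\<Sum>v\<in>UNIV. pmf ?pV v * (G v / N) powr s) = 1"
          using pos G by (simp add: powr_divide * flip: sum_divide_distrib) (simp add: c_def)
      qed (use F G pos in auto)
      also have "\<dots> = (\<Sum>(u, v)\<in>UNIV. pmf Q (u, v) * (F u * G v)) / (M * N)"
        by (simp add: sum_divide_distrib case_prod_beta)
      finally show ?thesis
        unfolding a_def[symmetric] c_def[symmetric] M_def[symmetric] N_def[symmetric]
        using pos by (simp add: pos_le_divide_eq mult.assoc)
    qed
  qed
  with s show ?thesis by (intro exI[of _ s]) auto
qed

text \<open>Induction on the block length: with the last symbols fixed, the induction hypothesis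
  bounds the inner expectation by a product of a function of \<open>u\<close> and a function of
  \<open>v\<close>, to which the one-letter inequality applies.\<close>

lemma reverse_Brascamp_Lieb_iid:
  fixes Q :: "('u::finite \<times> 'v::finite) pmf" and p :: "'u pmf" and q :: "'v pmf"
  assumes s: "0 < s" and c: "0 \<le> c"
    and single: "\<And>F G. (\<And>u. 0 \<le> F u) \<Longrightarrow> (\<And>v. 0 \<le> G v) \<Longrightarrow>
      c * (\<Sum>u\<in>UNIV. pmf p u * F u powr s) powr (1 / s) * (\<Sum>v\<in>UNIV. pmf q v * G v powr s) powr (1 / s)
      \<le> (\<Sum>(u, v)\<in>UNIV. pmf Q (u, v) * (F u * G v))"
    and F: "\<And>w. 0 \<le> F w" and G: "\<And>w. 0 \<le> G w"
  shows "c ^ n * (measure_pmf.expectation (iid n (fst d) p) (\<lambda>w. F w powr s)) powr (1 / s)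
           * (measure_pmf.expectation (iid n (snd d) q) (\<lambda>w. G w powr s)) powr (1 / s)
       \<le> measure_pmf.expectation (iid n d Q) (\<lambda>w. F (\<lambda>i. fst (w i)) * G (\<lambda>i. snd (w i)))"
  using F G
proof (induction n arbitrary: F G)
  case 0
  show ?case using 0 s by (simp add: powr_powr)
next
  case (Suc n)
  \<comment> \<open>The norm of the section of \<open>F\<close> at last symbol \<open>u\<close>. Its
    own norm under \<open>p\<close> is the norm of \<open>F\<close> on the longer block, because the
    exponent \<open>s\<close> is the same at both stages.\<close>
  define f where "f u = (measure_pmf.expectation (iid n (fst d) p) (\<lambda>w. F (w(n := u)) powr s)) powr (1 / s)" for u
  define g where "g v = (measure_pmf.expectation (iid n (snd d) q) (\<lambda>w. G (w(n := v)) powr s)) powr (1 / s)" for v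
  have fs: "f u powr s = measure_pmf.expectation (iid n (fst d) p) (\<lambda>w. F (w(n := u)) powr s)" for u
    unfolding f_def using s by (simp add: powr_powr integral_nonneg_AE)
  have gs: "g v powr s = measure_pmf.expectation (iid n (snd d) q) (\<lambda>w. G (w(n := v)) powr s)" for v
    unfolding g_def using s by (simp add: powr_powr integral_nonneg_AE)
  have upd: "(\<lambda>i. fst ((w(n := (u, v))) i)) = (\<lambda>i. fst (w i))(n := u)"
      "(\<lambda>i. snd ((w(n := (u, v))) i)) = (\<lambda>i. snd (w i))(n := v)" for w :: "nat \<Rightarrow> 'u \<times> 'v" and u v
    by auto
  have "c ^ Suc n * (measure_pmf.expectation (iid (Suc n) (fst d) p) (\<lambda>w. F w powr s)) powr (1 / s)
          * (measure_pmf.expectation (iid (Suc n) (snd d) q) (\<lambda>w. G w powr s)) powr (1 / s)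
      = c ^ n * (c * (\<Sum>u\<in>UNIV. pmf p u * f u powr s) powr (1 / s)
          * (\<Sum>v\<in>UNIV. pmf q v * g v powr s) powr (1 / s))"
    by (simp add: expectation_iid_Suc fs gs)
  also have "\<dots> \<le> c ^ n * (\<Sum>(u, v)\<in>UNIV. pmf Q (u, v) * (f u * g v))"
    using c by (intro mult_left_mono single) (auto simp: f_def g_def)
  also have "\<dots> = (\<Sum>(u, v)\<in>UNIV. pmf Q (u, v) * (c ^ n * f u * g v))"
    by (simp add: sum_distrib_left case_prod_beta algebra_simps)
  also have "\<dots> \<le> (\<Sum>(u, v)\<in>UNIV. pmf Q (u, v) * measure_pmf.expectation (iid n d Q)
      (\<lambda>w. F ((\<lambda>i. fst (w i))(n := u)) * G ((\<lambda>i. snd (w i))(n := v))))"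
    unfolding f_def g_def
    using Suc.IH[OF Suc.prems(1) Suc.prems(2)]
    by (intro sum_mono) (auto intro!: mult_left_mono)
  also have "\<dots> = measure_pmf.expectation (iid (Suc n) d Q) (\<lambda>w. F (\<lambda>i. fst (w i)) * G (\<lambda>i. snd (w i)))"
    unfolding expectation_iid_Suc by (intro sum.cong refl) (clarify, simp only: upd prod.case)
  finally show ?case .
qed

section \<open>Converse\<close>

lemma pmf_decision_pmf:
  "pmf (decision_pmf R \<Gamma> n k f g) h = measure_pmf.expectation (iid n undefined R)
     (\<lambda>w. measure_pmf.prob (dmc \<Gamma> k (f (\<lambda>i. fst (w i)))) {y. g (\<lambda>i. snd (w i)) y = h})"
  unfolding decision_pmf_def pmf_bind[of "iid n undefined R"]
  by (intro Bochner_Integration.integral_cong refl) (simp add: pmf_map vimage_def flip: map_pmf_def)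

abbreviation blocks :: "nat \<Rightarrow> (nat \<Rightarrow> 'y::finite) set" where
  "blocks k \<equiv> PiE_dflt {..<k} undefined (\<lambda>_. UNIV)"

lemma card_blocks: "card (blocks k :: (nat \<Rightarrow> 'y::finite) set) = CARD('y) ^ k"
  by (subst card_PiE_dflt) auto

text \<open>For a fixed output \<open>y\<close> the integrand is a function of the sensor's block
  times a function of the decision center's block, the form that the reverse inequality
  treats.\<close>

lemma pmf_decision_pmf_sum:
  fixes \<Gamma> :: "'x \<Rightarrow> 'y::finite pmf" and R :: "('u::finite \<times> 'v::finite) pmf"
  shows "pmf (decision_pmf R \<Gamma> n k f g) h = (\<Sum>y\<in>blocks k. measure_pmf.expectation (iid n undefined R)
     (\<lambda>w. pmf (dmc \<Gamma> k (f (\<lambda>i. fst (w i)))) y * of_bool (g (\<lambda>i. snd (w i)) y = h)))"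
proof -
  have "measure_pmf.prob (dmc \<Gamma> k x) S = (\<Sum>y\<in>blocks k. pmf (dmc \<Gamma> k x) y * of_bool (y \<in> S))" for x S
  proof -
    have "measure_pmf.prob (dmc \<Gamma> k x) S = measure_pmf.expectation (dmc \<Gamma> k x) (indicator S)"
      by simp
    also have "\<dots> = (\<Sum>y\<in>blocks k. indicator S y * pmf (dmc \<Gamma> k x) y)"
      by (intro integral_measure_pmf_real finite_PiE_dflt)
        (auto simp: dmc_def set_Pi_pmf PiE_dflt_def)
    finally show ?thesis by (simp add: indicator_def mult.commute)
  qed
  then show ?thesis
    by (simp add: pmf_decision_pmf)
qed

text \<open>Makes the output laws of all input blocks comparable up to \<open>c ^ k\<close>, which
  is subexponential in \<open>n\<close> when \<open>k\<close> is sublinear.\<close>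

lemma pmf_dmc_le:
  assumes c: "0 \<le> c" "\<And>x x' y. c * pmf (\<Gamma> x') y \<le> pmf (\<Gamma> x) y"
  shows "c ^ k * pmf (dmc \<Gamma> k x') y \<le> pmf (dmc \<Gamma> k x) y"
proof -
  have "c ^ k * (\<Prod>i<k. pmf (\<Gamma> (x' i)) (y i)) = (\<Prod>i<k. c * pmf (\<Gamma> (x' i)) (y i))"
    by (simp add: prod.distrib)
  also have "\<dots> \<le> (\<Prod>i<k. pmf (\<Gamma> (x i)) (y i))"
    using c by (intro prod_mono) auto
  finally show ?thesis by (auto simp: dmc_def pmf_Pi)
qed

text \<open>Both parts of the converse at once: either \<open>\<pi>\<close> has the sensor marginal
  of \<open>P\<close>, or the channel inputs are comparable and that marginal is free. It matters
  that \<open>s\<close> is chosen before \<open>n\<close>, \<open>k\<close> and the code, so that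
  the factors with exponents \<open>1 / s\<close> and \<open>2 / s\<close> remain
  subexponential.\<close>

lemma type2_error_ge:
  fixes P Q \<pi> :: "('u::finite \<times> 'v::finite) pmf" and \<Gamma> :: "'x \<Rightarrow> 'y::finite pmf"
  assumes Q: "\<And>u v. 0 < pmf Q (u, v)" and "0 < \<delta>" and c: "0 < c" "c \<le> 1"
    and snd_eq: "map_pmf snd \<pi> = map_pmf snd P"
    and fst_eq: "map_pmf fst \<pi> = map_pmf fst P \<or> (\<forall>x x' y. c * pmf (\<Gamma> x') y \<le> pmf (\<Gamma> x) y)"
  shows "\<exists>s>0. \<forall>n k f g. exp (- (relent \<pi> Q + \<delta>)) ^ n * (c ^ k) powr (1 / s)
      * ((1 - type1_error P \<Gamma> n k f g) / CARD('y) ^ k) powr (2 / s) \<le> type2_error Q \<Gamma> n k f g"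
proof -
  obtain s where s: "0 < s" "s \<le> 1" and single: "\<And>F G. (\<And>u. 0 \<le> F u) \<Longrightarrow> (\<And>v. 0 \<le> G v) \<Longrightarrow>
    exp (- (relent \<pi> Q + \<delta>))
      * (\<Sum>u\<in>UNIV. pmf (map_pmf fst \<pi>) u * F u powr s) powr (1 / s)
      * (\<Sum>v\<in>UNIV. pmf (map_pmf snd \<pi>) v * G v powr s) powr (1 / s)
    \<le> (\<Sum>(u, v)\<in>UNIV. pmf Q (u, v) * (F u * G v))"
    using reverse_Brascamp_Lieb[OF Q \<open>0 < \<delta>\<close>, of \<pi>] by auto
  let ?C = "exp (- (relent \<pi> Q + \<delta>))"
  have "?C ^ n * (c ^ k) powr (1 / s) * ((1 - type1_error P \<Gamma> n k f g) / CARD('y) ^ k) powr (2 / s)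
      \<le> type2_error Q \<Gamma> n k f g" for n k f g
  proof -
    define F where "F y u = pmf (dmc \<Gamma> k (f u)) y" for y u
    define G :: "(nat \<Rightarrow> 'y) \<Rightarrow> (nat \<Rightarrow> 'v) \<Rightarrow> real" where "G y v = of_bool (g v y = H0)" for y v
    have F01: "0 \<le> F y u" "F y u \<le> 1" for y u by (auto simp: F_def pmf_le_1)
    have G01: "0 \<le> G y v" "G y v \<le> 1" for y v by (auto simp: G_def)
    define E where "E R y = measure_pmf.expectation (iid n undefined R)
        (\<lambda>w. F y (\<lambda>i. fst (w i)) * G y (\<lambda>i. snd (w i)))" for R :: "('u \<times> 'v) pmf" and y
    have sumE: "pmf (decision_pmf R \<Gamma> n k f g) H0 = (\<Sum>y\<in>blocks k. E R y)" for R
      by (simp add: pmf_decision_pmf_sum E_def F_def G_def)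
    let ?a = "1 - type1_error P \<Gamma> n k f g"
    have "(\<Sum>h\<in>{H0, H1}. pmf (decision_pmf P \<Gamma> n k f g) h) = 1"
      using hyp.exhaust by (intro sum_pmf_eq_1) auto
    then have a: "?a = (\<Sum>y\<in>blocks k. E P y)"
      unfolding sumE[symmetric] type1_error_def by simp
    \<comment> \<open>Pigeonhole: some output carries at least the average share of the acceptance
      probability under \<open>P\<close>.\<close>
    have "\<exists>y\<in>blocks k. ?a / CARD('y) ^ k \<le> E P y"
    proof (rule ccontr)
      assume "\<not> ?thesis"
      then have "(\<Sum>y\<in>blocks k. E P y) < card (blocks k :: (nat \<Rightarrow> 'y) set) * (?a / CARD('y) ^ k)"
        by (intro sum_bounded_above_strict) (auto simp: card_blocks not_le)
      with a show False by (simp add: card_blocks)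
    qed
    then obtain y where y: "y \<in> blocks k" and ay: "?a / CARD('y) ^ k \<le> E P y" by blast
    have a0: "0 \<le> ?a / CARD('y) ^ k" by (simp add: type1_error_def pmf_le_1)
    let ?IU = "\<lambda>p. measure_pmf.expectation (iid n (fst (undefined :: 'u \<times> 'v)) p)"
    let ?IV = "\<lambda>p. measure_pmf.expectation (iid n (snd (undefined :: 'u \<times> 'v)) p)"
    \<comment> \<open>Both factors lie in [0, 1], so dropping either of them only increases the
      expectation; what remains depends on one marginal of \<open>P\<close>.\<close>
    have "E P y \<le> measure_pmf.expectation (iid n undefined P) (\<lambda>w. F y (\<lambda>i. fst (w i)))"
      unfolding E_def using F01 G01 by (intro integral_mono) (auto intro: mult_left_le)
    also have "\<dots> = ?IU (map_pmf fst P) (F y)"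
      by (simp flip: map_iid)
    finally have EU: "E P y \<le> ?IU (map_pmf fst P) (F y)" .
    have "E P y \<le> measure_pmf.expectation (iid n undefined P) (\<lambda>w. G y (\<lambda>i. snd (w i)))"
      unfolding E_def using F01 G01 by (intro integral_mono) (auto intro: mult_left_le_one_le)
    also have "\<dots> = ?IV (map_pmf snd \<pi>) (G y)"
      by (simp add: snd_eq flip: map_iid)
    also have "G y = (\<lambda>w. G y w powr s)" by (auto simp: G_def)
    finally have EV: "E P y \<le> ?IV (map_pmf snd \<pi>) (\<lambda>w. G y w powr s)" .
    have "c ^ k * E P y \<le> c ^ k * ?IU (map_pmf fst P) (F y)"
      using EU c by simp
    \<comment> \<open>With equal marginals \<open>c ^ k \<le> 1\<close> suffices. Otherwise every
      value of \<open>F y\<close>, times \<open>c ^ k\<close>, is below every other value, hence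
      below the mean under any law.\<close>
    also have "\<dots> \<le> ?IU (map_pmf fst \<pi>) (F y)"
    proof (cases "map_pmf fst \<pi> = map_pmf fst P")
      case True
      have "c ^ k \<le> 1" using c by (simp add: power_le_one)
      then show ?thesis
        using F01 by (simp add: True mult_left_le_one_le integral_nonneg_AE c(1) less_imp_le)
    next
      case False
      then have "c ^ k * F y u' \<le> F y u" for u u'
        unfolding F_def using fst_eq c by (intro pmf_dmc_le) auto
      then have *: "c ^ k * F y u' \<le> ?IU (map_pmf fst \<pi>) (F y)" for u'
        using integral_mono[of "iid n (fst (undefined :: 'u \<times> 'v)) (map_pmf fst \<pi>)" "\<lambda>_. c ^ k * F y u'" "F y"] by simp
      have "c ^ k * ?IU (map_pmf fst P) (F y) = ?IU (map_pmf fst P) (\<lambda>u. c ^ k * F y u)" by simp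
      also have "\<dots> \<le> ?IU (map_pmf fst P) (\<lambda>_. ?IU (map_pmf fst \<pi>) (F y))"
        by (intro integral_mono *) auto
      finally show ?thesis by simp
    qed
    \<comment> \<open>Here \<open>s \<le> 1\<close> is used: numbers in [0, 1] grow when raised to
      the power \<open>s\<close>.\<close>
    also have "\<dots> \<le> ?IU (map_pmf fst \<pi>) (\<lambda>u. F y u powr s)"
      using F01 s powr_mono'[of s 1] by (intro integral_mono) auto
    finally have EU': "c ^ k * E P y \<le> ?IU (map_pmf fst \<pi>) (\<lambda>u. F y u powr s)" .
    have EP0: "0 \<le> E P y" using a0 ay by linarith
    have "?C ^ n * (c ^ k) powr (1 / s) * (?a / CARD('y) ^ k) powr (2 / s)
        \<le> ?C ^ n * (c ^ k) powr (1 / s) * E P y powr (2 / s)"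
      using s a0 ay by (intro mult_left_mono powr_mono2) auto
    also have "\<dots> = ?C ^ n * (c ^ k * E P y) powr (1 / s) * E P y powr (1 / s)"
      using c EP0 by (simp add: powr_mult flip: powr_add)
    also have "\<dots> \<le> ?C ^ n * ?IU (map_pmf fst \<pi>) (\<lambda>u. F y u powr s) powr (1 / s)
        * ?IV (map_pmf snd \<pi>) (\<lambda>w. G y w powr s) powr (1 / s)"
      using EU' EV EP0 c s by (intro mult_mono mult_left_mono powr_mono2) auto
    also have "\<dots> \<le> E Q y"
      unfolding E_def using s F01 G01 single by (intro reverse_Brascamp_Lieb_iid) auto
    also have "\<dots> \<le> (\<Sum>y\<in>blocks k. E Q y)"
      using y F01 G01 by (intro member_le_sum finite_PiE_dflt) (auto simp: E_def intro!: integral_nonneg_AE)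
    finally show ?thesis by (simp add: type2_error_def sumE)
  qed
  with s show ?thesis by blast
qed

lemma achievable_imp_le_relent:
  fixes P Q \<pi> :: "('u::finite \<times> 'v::finite) pmf" and \<Gamma> :: "'x \<Rightarrow> 'y::finite pmf"
  assumes Q: "\<And>u v. 0 < pmf Q (u, v)" and b: "1 < b" and \<epsilon>: "\<epsilon> < 1"
    and k: "(\<lambda>n. real (k n) / real n) \<longlonglongrightarrow> 0"
    and c: "0 < c" "c \<le> 1"
    and snd_eq: "map_pmf snd \<pi> = map_pmf snd P"
    and fst_eq: "map_pmf fst \<pi> = map_pmf fst P \<or> (\<forall>x x' y. c * pmf (\<Gamma> x') y \<le> pmf (\<Gamma> x) y)"
    and ach: "achievable b P Q \<Gamma> k \<epsilon> \<theta>"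
  shows "\<theta> \<le> relent \<pi> Q / ln b"
proof -
  have lnb: "0 < ln b" using b by simp
  have "\<theta> * ln b \<le> relent \<pi> Q + \<delta>" if "0 < \<delta>" for \<delta>
  proof -
    define D where "D = relent \<pi> Q + \<delta>"
    obtain s where s: "0 < s" and ge: "\<And>n k f g. exp (- D) ^ n * (c ^ k) powr (1 / s)
        * ((1 - type1_error P \<Gamma> n k f g) / CARD('y) ^ k) powr (2 / s) \<le> type2_error Q \<Gamma> n k f g"
      using type2_error_ge[OF Q \<open>0 < \<delta>\<close> c snd_eq fst_eq] unfolding D_def by blast
    from ach obtain f g
      where a: "limsup (\<lambda>n. ereal (type1_error P \<Gamma> n (k n) (f n) (g n))) \<le> ereal \<epsilon>"
        and \<theta>: "ereal \<theta> \<le> liminf (\<lambda>n. error_exponent b n (type2_error Q \<Gamma> n (k n) (f n) (g n)))"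
      unfolding achievable_def by blast
    \<comment> \<open>Any level strictly between \<open>\<epsilon>\<close> and 1 serves: the
      acceptance probability under \<open>P\<close> then stays above the positive constant
      \<open>1 - e\<close> for all large \<open>n\<close>.\<close>
    define e where "e = (1 + \<epsilon>) / 2"
    have e: "\<epsilon> < e" "e < 1" using \<epsilon> by (auto simp: e_def)
    have "limsup (\<lambda>n. ereal (type1_error P \<Gamma> n (k n) (f n) (g n))) < ereal e"
      using a e by (meson ereal_less_eq(3) le_less_trans less_ereal.simps(1))
    then have ev: "\<forall>\<^sub>F n in sequentially. type1_error P \<Gamma> n (k n) (f n) (g n) < e"
      by (auto dest!: Limsup_lessD)
    define Y where "Y = real CARD('y)"
    have Y: "0 < Y" by (simp add: Y_def)
    \<comment> \<open>The exponent of the explicit lower bound on the type-II error. Everything but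
      \<open>D\<close> carries a factor \<open>k n / n\<close> or \<open>1 / n\<close>, so the limit
      is \<open>D / ln b\<close>.\<close>
    define r where "r n = (D + (real (k n) / real n) * ((2 * ln Y - ln c) / s)
        - (1 / real n) * (2 / s * ln (1 - e))) / ln b" for n
    have "\<forall>\<^sub>F n in sequentially. error_exponent b n (type2_error Q \<Gamma> n (k n) (f n) (g n)) \<le> ereal (r n)"
      using ev eventually_gt_at_top[of 0]
    proof eventually_elim
      case (elim n)
      let ?\<beta> = "type2_error Q \<Gamma> n (k n) (f n) (g n)"
      let ?L = "exp (- D) ^ n * (c ^ k n) powr (1 / s) * ((1 - e) / Y ^ k n) powr (2 / s)"
      have "?L \<le> exp (- D) ^ n * (c ^ k n) powr (1 / s)
          * ((1 - type1_error P \<Gamma> n (k n) (f n) (g n)) / CARD('y) ^ k n) powr (2 / s)"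
        using elim e s Y by (intro mult_left_mono powr_mono2) (auto simp: Y_def intro!: divide_right_mono)
      also have "\<dots> \<le> ?\<beta>" by (rule ge)
      finally have L: "?L \<le> ?\<beta>" .
      have L0: "0 < ?L" using c e Y by simp
      have "ln ?L = - (real n * D) + real (k n) * ln c / s + 2 / s * (ln (1 - e) - real (k n) * ln Y)"
        using c e Y by (simp add: ln_mult ln_div ln_powr ln_realpow)
      then have "- ln ?\<beta> \<le> real n * D - real (k n) * ln c / s - 2 / s * (ln (1 - e) - real (k n) * ln Y)"
        using L L0 ln_mono[of ?L ?\<beta>] by linarith
      then have "(1 / real n) * (- ln ?\<beta>) \<le> (1 / real n) *
          (real n * D - real (k n) * ln c / s - 2 / s * (ln (1 - e) - real (k n) * ln Y))"
        by (intro mult_left_mono) auto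
      also have "\<dots> = r n * ln b"
        using elim s lnb by (simp add: r_def field_simps)
      finally have "(1 / real n) * (- ln ?\<beta>) / ln b \<le> r n"
        using lnb by (simp only: pos_divide_le_eq)
      then have "- (1 / real n) * log b ?\<beta> \<le> r n"
        by (simp add: log_def)
      then show ?case
        using L L0 by (auto simp: error_exponent_def)
    qed
    then have "ereal \<theta> \<le> liminf (\<lambda>n. ereal (r n))"
      by (intro order_trans[OF \<theta> Liminf_mono])
    moreover have "r \<longlonglongrightarrow> (D + 0 * ((2 * ln Y - ln c) / s) - 0 * (2 / s * ln (1 - e))) / ln b"
      unfolding r_def using lnb lim_1_over_n by (intro tendsto_intros k) auto
    then have "liminf (\<lambda>n. ereal (r n)) = ereal (D / ln b)"
      by (intro lim_imp_Liminf) auto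
    ultimately show ?thesis
      using lnb by (simp add: D_def field_simps)
  qed
  then show ?thesis
    using lnb by (simp add: field_le_epsilon pos_le_divide_eq)
qed

section \<open>Achievability\<close>

text \<open>Markov's inequality for a product over the block. The lower bound on the product is
  asked only of blocks in the support, where logarithms of factors will make sense.\<close>

lemma prob_iid_le_expectation_prod:
  fixes p :: "'a::finite pmf" and h :: "'a \<Rightarrow> real"
  assumes "\<And>a. 0 \<le> h a" and le: "\<And>w. w \<in> S \<Longrightarrow> (\<And>i. i < n \<Longrightarrow> w i \<in> set_pmf p) \<Longrightarrow> c \<le> (\<Prod>i<n. h (w i))"
  shows "c * measure_pmf.prob (iid n d p) S \<le> (\<Sum>a\<in>UNIV. pmf p a * h a) ^ n"
proof -
  have "c * measure_pmf.prob (iid n d p) S = measure_pmf.expectation (iid n d p) (\<lambda>w. c * indicator S w)"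
    by simp
  also have "\<dots> \<le> measure_pmf.expectation (iid n d p) (\<lambda>w. \<Prod>i<n. h (w i))"
    by (intro integral_mono_AE)
      (auto simp: AE_measure_pmf_iff set_Pi_pmf PiE_dflt_def indicator_def assms(1) intro!: le prod_nonneg)
  finally show ?thesis
    using assms(1) by (simp add: expectation_iid_prod)
qed

text \<open>A weak law for the sum of \<open>ln (h (w i))\<close>, obtained from a one-sided
  Chernoff bound with an exponentially small probability.\<close>

lemma prob_prod_lt_tendsto_0:
  fixes p :: "'a::finite pmf" and h :: "'a \<Rightarrow> real"
  assumes pos: "\<And>a. 0 < pmf p a \<Longrightarrow> 0 < h a" and "0 < \<delta>"
  shows "(\<lambda>n. measure_pmf.prob (iid n d p)
    {w. (\<Prod>i<n. h (w i)) < exp (real n * ((\<Sum>a\<in>UNIV. pmf p a * ln (h a)) - \<delta>))}) \<longlonglongrightarrow> 0"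
proof -
  define m where "m = (\<Sum>a\<in>UNIV. pmf p a * ln (h a)) - \<delta>"
  define X where "X a = ln (h a) - m" for a
  define \<phi> where "\<phi> s = (\<Sum>a\<in>UNIV. pmf p a * exp (- (s * X a)))" for s
  have EX: "(\<Sum>a\<in>UNIV. pmf p a * X a) = \<delta>"
    by (simp add: X_def m_def right_diff_distrib sum_subtractf sum_pmf_UNIV flip: sum_distrib_right)
  \<comment> \<open>\<open>\<phi>\<close> is the Laplace transform of \<open>X\<close>, whose mean
    is \<open>\<delta> > 0\<close>. Since \<open>\<phi> 0 = 1\<close> and the slope there is
    negative, some \<open>s > 0\<close> gives \<open>\<phi> s < 1\<close>, the base of the Chernoff
    bound.\<close>
  have "DERIV \<phi> 0 :> - \<delta>"
    unfolding \<phi>_def EX[symmetric] sum_negf[symmetric]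
    by (auto intro!: derivative_eq_intros sum.cong)
  from DERIV_neg_dec_right[OF this] \<open>0 < \<delta>\<close>
  obtain s0 where "0 < s0" "\<forall>s>0. s < s0 \<longrightarrow> \<phi> (0 + s) < \<phi> 0" by auto
  then have "\<phi> (s0 / 2) < \<phi> 0" "0 < s0 / 2" by auto
  then obtain s where s: "0 < s" and "\<phi> s < \<phi> 0" by blast
  moreover have "\<phi> 0 = 1" by (simp add: \<phi>_def sum_pmf_UNIV)
  moreover have "0 \<le> \<phi> s" by (auto simp: \<phi>_def intro!: sum_nonneg)
  ultimately have lim: "(\<lambda>n. \<phi> s ^ n) \<longlonglongrightarrow> 0"
    by (intro LIMSEQ_power_zero) auto
  have "1 * measure_pmf.prob (iid n d p) {w. (\<Prod>i<n. h (w i)) < exp (real n * m)} \<le> \<phi> s ^ n" for n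
    unfolding \<phi>_def
  proof (rule prob_iid_le_expectation_prod)
    fix w assume w: "w \<in> {w. (\<Prod>i<n. h (w i)) < exp (real n * m)}" and supp: "\<And>i. i < n \<Longrightarrow> w i \<in> set_pmf p"
    then have h: "0 < h (w i)" if "i < n" for i using pos pmf_positive that by metis
    have "exp (\<Sum>i<n. ln (h (w i))) = (\<Prod>i<n. h (w i))"
      using h by (simp add: exp_sum)
    also have "\<dots> < exp (real n * m)" using w by simp
    finally have "(\<Sum>i<n. X (w i)) < 0" by (simp add: X_def sum_subtractf)
    then have "0 \<le> - (s * (\<Sum>i<n. X (w i)))" using s by (simp add: mult_le_0_iff)
    also have "\<dots> = (\<Sum>i<n. - (s * X (w i)))" by (simp add: sum_distrib_left sum_negf)
    finally have "1 \<le> exp (\<Sum>i<n. - (s * X (w i)))" by simp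
    then show "1 \<le> (\<Prod>i<n. exp (- (s * X (w i))))" by (simp add: exp_sum)
  qed simp
  then show ?thesis
    unfolding m_def by (intro tendsto_sandwich[OF _ _ tendsto_const lim]) auto
qed

lemma prob_dmc_avoid:
  "measure_pmf.prob (dmc \<Gamma> k (\<lambda>_. x)) {y. \<forall>i<k. y i \<noteq> c} = (1 - pmf (\<Gamma> x) c) ^ k"
proof -
  have "{y. \<forall>i<k. y i \<noteq> c} = Pi {..<k} (\<lambda>_. - {c})" by auto
  moreover have "measure_pmf.prob (\<Gamma> x) (- {c}) = 1 - pmf (\<Gamma> x) c"
    using measure_pmf.prob_compl[of "{c}" "\<Gamma> x"] by (simp add: measure_pmf_single Compl_eq_Diff_UNIV)
  ultimately show ?thesis
    unfolding dmc_def by (simp add: measure_Pi_pmf_Pi)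
qed

text \<open>Serves both parts: either \<open>x1\<close> never produces \<open>c\<close> and one bit
  is conveyed without false acceptance, or \<open>A\<close> is constantly 1 and the sensor has
  nothing to report.\<close>

lemma achievableI:
  fixes P Q :: "('u::finite \<times> 'v::finite) pmf" and \<Gamma> :: "'x \<Rightarrow> 'y::finite pmf"
    and A :: "'u \<Rightarrow> real" and B :: "'v \<Rightarrow> real"
  assumes b: "1 < b" and \<epsilon>: "0 \<le> \<epsilon>" and k: "filterlim k at_top sequentially"
    and A: "\<And>u. 0 \<le> A u" "\<And>u. 0 < pmf (map_pmf fst P) u \<Longrightarrow> 0 < A u"
    and B: "\<And>v. 0 \<le> B v" "\<And>v. 0 < pmf (map_pmf snd P) v \<Longrightarrow> 0 < B v"
    and QAB: "(\<Sum>(u, v)\<in>UNIV. pmf Q (u, v) * (A u * B v)) \<le> 1"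
    and \<theta>: "\<theta> * ln b < (\<Sum>u\<in>UNIV. pmf (map_pmf fst P) u * ln (A u))
        + (\<Sum>v\<in>UNIV. pmf (map_pmf snd P) v * ln (B v))"
    and x0: "0 < pmf (\<Gamma> x0) c" and x1: "pmf (\<Gamma> x1) c = 0 \<or> (\<forall>u. A u = 1)"
  shows "achievable b P Q \<Gamma> k \<epsilon> \<theta>"
proof -
  define \<alpha> where "\<alpha> = (\<Sum>u\<in>UNIV. pmf (map_pmf fst P) u * ln (A u))"
  define \<beta> where "\<beta> = (\<Sum>v\<in>UNIV. pmf (map_pmf snd P) v * ln (B v))"
  \<comment> \<open>Half of the slack, so that the two thresholds \<open>\<alpha> - \<delta>\<close>
    and \<open>\<beta> - \<delta>\<close> add up to exactly \<open>\<theta> * ln b\<close>.\<close>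
  define \<delta> where "\<delta> = (\<alpha> + \<beta> - \<theta> * ln b) / 2"
  have \<delta>: "0 < \<delta>" using \<theta> by (simp add: \<delta>_def \<alpha>_def \<beta>_def)
  define T where "T n = {u. exp (real n * (\<alpha> - \<delta>)) \<le> (\<Prod>i<n. A (u i))}" for n
  define S where "S n = {v. exp (real n * (\<beta> - \<delta>)) \<le> (\<Prod>i<n. B (v i))}" for n
  define f :: "nat \<Rightarrow> ('u, 'x) encoder" where "f n u = (if u \<in> T n then (\<lambda>_. x0) else (\<lambda>_. x1))" for n u
  define g :: "nat \<Rightarrow> ('v, 'y) decider"
    where "g n v y = (if v \<in> S n \<and> (\<exists>i<k n. y i = c) then H0 else H1)" for n v y
  let ?t1 = "\<lambda>n. type1_error P \<Gamma> n (k n) (f n) (g n)"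
  let ?t2 = "\<lambda>n. type2_error Q \<Gamma> n (k n) (f n) (g n)"
  let ?IU = "\<lambda>n. iid n (fst (undefined :: 'u \<times> 'v)) (map_pmf fst P)"
  let ?IV = "\<lambda>n. iid n (snd (undefined :: 'u \<times> 'v)) (map_pmf snd P)"
  \<comment> \<open>Union bound: a false alarm requires that one of the two local tests fails or
    that \<open>c\<close> does not occur in \<open>k n\<close> repetitions of
    \<open>x0\<close>.\<close>
  have t1: "?t1 n \<le> measure_pmf.prob (?IU n) (- T n) + measure_pmf.prob (?IV n) (- S n)
      + (1 - pmf (\<Gamma> x0) c) ^ k n" for n
  proof -
    have le: "measure_pmf.prob (dmc \<Gamma> (k n) (f n u)) {y. g n v y = H1}
        \<le> indicator (- T n) u + indicator (- S n) v + (1 - pmf (\<Gamma> x0) c) ^ k n" for u v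
    proof (cases "u \<in> T n \<and> v \<in> S n")
      case True
      then have "{y. g n v y = H1} = {y. \<forall>i<k n. y i \<noteq> c}" by (auto simp: g_def)
      with True show ?thesis by (simp add: f_def prob_dmc_avoid)
    next
      case False
      then have "(1::real) \<le> indicator (- T n) u + indicator (- S n) v" by (auto simp: indicator_def)
      moreover have "0 \<le> (1 - pmf (\<Gamma> x0) c) ^ k n" by (simp add: pmf_le_1)
      ultimately show ?thesis by (smt (verit) measure_pmf.prob_le_1)
    qed
    have "?t1 n \<le> measure_pmf.expectation (iid n undefined P)
      (\<lambda>w. indicator (- T n) (\<lambda>i. fst (w i)) + indicator (- S n) (\<lambda>i. snd (w i)) + (1 - pmf (\<Gamma> x0) c) ^ k n)"
      unfolding type1_error_def pmf_decision_pmf by (intro integral_mono le) auto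
    also have "\<dots> = measure_pmf.expectation (iid n undefined P) (\<lambda>w. indicator (- T n) (\<lambda>i. fst (w i)))
        + measure_pmf.expectation (iid n undefined P) (\<lambda>w. indicator (- S n) (\<lambda>i. snd (w i)))
        + (1 - pmf (\<Gamma> x0) c) ^ k n"
      by simp
    also have "measure_pmf.expectation (iid n undefined P) (\<lambda>w. indicator (- T n) (\<lambda>i. fst (w i)) :: real)
        = measure_pmf.expectation (?IU n) (indicator (- T n))"
      by (simp del: Bochner_Integration.integral_indicator flip: map_iid)
    also have "measure_pmf.expectation (iid n undefined P) (\<lambda>w. indicator (- S n) (\<lambda>i. snd (w i)) :: real)
        = measure_pmf.expectation (?IV n) (indicator (- S n))"
      by (simp del: Bochner_Integration.integral_indicator flip: map_iid)
    finally show ?thesis by simp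
  qed
  have "(\<lambda>n. measure_pmf.prob (?IU n) (- T n)) \<longlonglongrightarrow> 0"
    using prob_prod_lt_tendsto_0[OF A(2) \<delta>] by (simp add: T_def \<alpha>_def Collect_neg_eq[symmetric] not_le)
  moreover have "(\<lambda>n. measure_pmf.prob (?IV n) (- S n)) \<longlonglongrightarrow> 0"
    using prob_prod_lt_tendsto_0[OF B(2) \<delta>] by (simp add: S_def \<beta>_def Collect_neg_eq[symmetric] not_le)
  moreover have "(\<lambda>n. (1 - pmf (\<Gamma> x0) c) ^ k n) \<longlonglongrightarrow> 0"
    using x0 pmf_le_1[of "\<Gamma> x0" c] by (intro filterlim_compose[OF LIMSEQ_power_zero k]) auto
  ultimately have "(\<lambda>n. measure_pmf.prob (?IU n) (- T n) + measure_pmf.prob (?IV n) (- S n)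
      + (1 - pmf (\<Gamma> x0) c) ^ k n) \<longlonglongrightarrow> 0 + 0 + 0"
    by (intro tendsto_add)
  then have "limsup (\<lambda>n. ereal (measure_pmf.prob (?IU n) (- T n) + measure_pmf.prob (?IV n) (- S n)
      + (1 - pmf (\<Gamma> x0) c) ^ k n)) = ereal 0"
    by (intro lim_imp_Limsup) auto
  moreover have "limsup (\<lambda>n. ereal (?t1 n)) \<le> limsup (\<lambda>n. ereal (measure_pmf.prob (?IU n) (- T n)
      + measure_pmf.prob (?IV n) (- S n) + (1 - pmf (\<Gamma> x0) c) ^ k n))"
    using t1 by (intro Limsup_mono) auto
  ultimately have "limsup (\<lambda>n. ereal (?t1 n)) \<le> ereal 0" by simp
  also have "ereal 0 \<le> ereal \<epsilon>" using \<epsilon> by simp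
  finally have limsup: "limsup (\<lambda>n. ereal (?t1 n)) \<le> ereal \<epsilon>" .
  have t2: "?t2 n \<le> exp (- (real n * (\<theta> * ln b)))" for n
  proof -
    have le: "measure_pmf.prob (dmc \<Gamma> (k n) (f n u)) {y. g n v y = H0}
        \<le> of_bool (u \<in> T n \<and> v \<in> S n)" for u v
    proof (cases "u \<in> T n \<and> v \<in> S n")
      case True
      then show ?thesis by simp
    next
      case False
      \<comment> \<open>Acceptance needs both local tests to pass. If the sensor's test fails, then
        \<open>A\<close> is not constantly 1, as that would give \<open>\<alpha> = 0\<close> and a
        threshold of at most 1; so \<open>x1\<close> was sent and cannot yield
        \<open>c\<close>.\<close>
      have "measure_pmf.prob (dmc \<Gamma> (k n) (f n u)) {y. g n v y = H0} = 0"
      proof (cases "v \<in> S n")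
        case True
        with False have u: "u \<notin> T n" by simp
        have "\<not> (\<forall>u. A u = 1)"
        proof
          assume A1: "\<forall>u. A u = 1"
          then have "\<alpha> = 0" by (simp add: \<alpha>_def)
          with A1 \<delta> u show False by (simp add: T_def mult_nonneg_nonpos)
        qed
        with x1 have "c \<notin> set_pmf (\<Gamma> x1)" by (simp add: set_pmf_iff)
        with u have "{y. g n v y = H0} \<inter> set_pmf (dmc \<Gamma> (k n) (f n u)) = {}"
          by (auto simp: g_def f_def dmc_def set_Pi_pmf PiE_dflt_def split: if_splits)
        then show ?thesis by (simp add: measure_pmf_zero_iff Int_commute)
      qed (simp add: g_def)
      then show ?thesis by simp
    qed
    let ?W = "{w. (\<lambda>i. fst (w i)) \<in> T n \<and> (\<lambda>i. snd (w i)) \<in> S n}"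
    have "?t2 n \<le> measure_pmf.expectation (iid n undefined Q) (indicator ?W)"
      unfolding type2_error_def pmf_decision_pmf
      by (intro integral_mono) (auto simp: indicator_def of_bool_def intro!: order_trans[OF le])
    then have "exp (real n * (\<theta> * ln b)) * ?t2 n \<le> exp (real n * (\<theta> * ln b)) * measure_pmf.prob (iid n undefined Q) ?W"
      by simp
    \<comment> \<open>On the acceptance event the product of \<open>A\<close> and \<open>B\<close>
      over the block reaches \<open>exp (real n * (\<theta> * ln b))\<close>, while its mean under
      \<open>Q\<close> is at most 1.\<close>
    also have "\<dots> \<le> (\<Sum>i\<in>UNIV. pmf Q i * (A (fst i) * B (snd i))) ^ n"
    proof (rule prob_iid_le_expectation_prod)
      fix w :: "nat \<Rightarrow> 'u \<times> 'v" assume w: "w \<in> ?W"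
      have "exp (real n * (\<theta> * ln b)) = exp (real n * (\<alpha> - \<delta>)) * exp (real n * (\<beta> - \<delta>))"
        by (simp add: \<delta>_def field_simps flip: exp_add)
      also have "\<dots> \<le> (\<Prod>i<n. A (fst (w i))) * (\<Prod>i<n. B (snd (w i)))"
        using w A(1) B(1) by (intro mult_mono) (auto simp: T_def S_def intro: prod_nonneg)
      finally show "exp (real n * (\<theta> * ln b)) \<le> (\<Prod>i<n. A (fst (w i)) * B (snd (w i)))"
        by (simp add: prod.distrib)
    qed (use A(1) B(1) in auto)
    also have "\<dots> \<le> 1"
      using QAB A(1) B(1) by (intro power_le_one sum_nonneg) (auto simp: case_prod_beta)
    finally show ?thesis by (simp add: exp_minus field_simps)
  qed
  have "ereal \<theta> \<le> liminf (\<lambda>n. error_exponent b n (?t2 n))"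
  proof (rule Liminf_bounded)
    show "\<forall>\<^sub>F n in sequentially. ereal \<theta> \<le> error_exponent b n (?t2 n)"
      using eventually_gt_at_top[of 0]
    proof eventually_elim
      case (elim n)
      show ?case
      proof (cases "?t2 n = 0")
        case False
        then have "0 < ?t2 n" by (simp add: type2_error_def pmf_pos)
        then have "ln (?t2 n) \<le> - (real n * (\<theta> * ln b))"
          using t2[of n] ln_mono by fastforce
        then have "\<theta> \<le> - (1 / real n) * log b (?t2 n)"
          using elim b by (simp add: log_def field_simps)
        then show ?thesis using False by (simp add: error_exponent_def)
      qed (simp add: error_exponent_def)
    qed
  qed
  with limsup show ?thesis unfolding achievable_def by blast
qed

section \<open>The minimising coupling\<close>

lemma pmf_map_fst: "pmf (map_pmf fst (\<pi> :: ('u::finite \<times> 'v::finite) pmf)) u = (\<Sum>v\<in>UNIV. pmf \<pi> (u, v))"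
proof -
  have "pmf (map_pmf fst \<pi>) u = (\<Sum>u'\<in>UNIV. \<Sum>v\<in>UNIV. if u' = u then pmf \<pi> (u', v) else 0)"
    using sum_map_pmf[of fst \<pi> "\<lambda>a. if a = u then 1 else 0"]
    by (simp add: sum_UNIV_prod if_distrib[of "\<lambda>x. _ * x"] cong: if_cong)
  also have "\<dots> = (\<Sum>v\<in>UNIV. pmf \<pi> (u, v))"
    by (subst sum.swap) simp
  finally show ?thesis .
qed

lemma pmf_map_snd: "pmf (map_pmf snd (\<pi> :: ('u::finite \<times> 'v::finite) pmf)) v = (\<Sum>u\<in>UNIV. pmf \<pi> (u, v))"
  using sum_map_pmf[of snd \<pi> "\<lambda>a. if a = v then 1 else 0"]
  by (simp add: sum_UNIV_prod if_distrib[of "\<lambda>x. _ * x"] cong: if_cong)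

lemma mem_couplings_iff:
  fixes \<pi> :: "('u::finite \<times> 'v::finite) pmf"
  shows "\<pi> \<in> couplings p q \<longleftrightarrow>
    (\<forall>u. (\<Sum>v\<in>UNIV. pmf \<pi> (u, v)) = pmf p u) \<and> (\<forall>v. (\<Sum>u\<in>UNIV. pmf \<pi> (u, v)) = pmf q v)"
  by (auto simp: couplings_def pmf_eq_iff pmf_map_fst pmf_map_snd)

lemma ex_pmf:
  fixes x :: "'a::finite \<Rightarrow> real"
  assumes nn: "\<And>i. 0 \<le> x i" and "sum x UNIV = 1"
  shows "\<exists>p. pmf p = x"
proof -
  have "pmf (embed_pmf x) i = x i" for i
    using assms by (intro pmf_embed_pmf) (auto simp: nn_integral_count_space_finite sum_ennreal)
  then show ?thesis by (intro exI[of _ "embed_pmf x"]) auto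
qed

lemma ex_coupling:
  fixes x :: "'u::finite \<times> 'v::finite \<Rightarrow> real"
  assumes nn: "\<And>i. 0 \<le> x i"
    and row: "\<And>u. (\<Sum>v\<in>UNIV. x (u, v)) = pmf p u" and col: "\<And>v. (\<Sum>u\<in>UNIV. x (u, v)) = pmf q v"
  shows "\<exists>\<pi>\<in>couplings p q. pmf \<pi> = x"
proof -
  have "sum x UNIV = 1" by (simp add: sum_UNIV_prod row sum_pmf_UNIV)
  with nn obtain \<pi> where "pmf \<pi> = x" using ex_pmf by blast
  then show ?thesis by (intro bexI[of _ \<pi>]) (simp_all add: mem_couplings_iff row col)
qed

lemma pair_pmf_in_couplings: "pair_pmf p q \<in> couplings p q"
  by (simp add: couplings_def map_fst_pair_pmf map_snd_pair_pmf)

section \<open>Existence of the minimiser\<close>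

lemma continuous_on_mult_ln_divide:
  assumes "0 < (c::real)"
  shows "continuous_on {0..} (\<lambda>t. t * ln (t / c))"
  unfolding continuous_on_def
proof
  fix t :: real assume "t \<in> {0..}"
  then consider "t = 0" | "0 < t" by fastforce
  then show "((\<lambda>t. t * ln (t / c)) \<longlongrightarrow> t * ln (t / c)) (at t within {0..})"
  proof cases
    case 1
    have "((\<lambda>t. t * ln (t / c)) \<longlongrightarrow> 0) (at_right 0)" using assms by real_asymp
    with 1 show ?thesis by (simp add: at_within_Ici_at_right)
  next
    case 2
    then show ?thesis using assms by (intro tendsto_intros) auto
  qed
qed

text \<open>Compactness: seen as vectors, the couplings form a closed bounded set, nonempty because
  of the product law, and the divergence is continuous on it, also where cells vanish.\<close>

lemma ex_I_projection:
  fixes Q :: "('u::finite \<times> 'v::finite) pmf"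
  assumes Q: "\<And>i. 0 < pmf Q i"
  shows "\<exists>\<pi>\<in>couplings p q. \<forall>\<pi>'\<in>couplings p q. relent \<pi> Q \<le> relent \<pi>' Q"
proof -
  define K :: "(real ^ ('u \<times> 'v)) set" where "K = {x. (\<forall>i. 0 \<le> x $ i) \<and>
    (\<forall>u. (\<Sum>v\<in>UNIV. x $ (u, v)) = pmf p u) \<and> (\<forall>v. (\<Sum>u\<in>UNIV. x $ (u, v)) = pmf q v)}"
  define F where "F x = (\<Sum>i\<in>UNIV. x $ i * ln (x $ i / pmf Q i))" for x :: "real ^ ('u \<times> 'v)"
  have vec: "(\<chi> i. pmf \<pi> i) \<in> K \<and> F (\<chi> i. pmf \<pi> i) = relent \<pi> Q" if "\<pi> \<in> couplings p q" for \<pi>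
    using that by (simp add: K_def F_def relent_def mem_couplings_iff)
  have "K \<noteq> {}" using vec[OF pair_pmf_in_couplings] by blast
  moreover have "compact K"
    unfolding compact_eq_bounded_closed
  proof
    have "norm x \<le> real CARD('u \<times> 'v)" if "x \<in> K" for x
    proof -
      have "norm x \<le> (\<Sum>i\<in>UNIV. \<bar>x $ i\<bar>)" by (rule norm_le_l1_cart)
      also have "\<dots> \<le> (\<Sum>i\<in>(UNIV :: ('u \<times> 'v) set). 1)"
      proof (rule sum_mono)
        fix i
        have "x $ (fst i, snd i) \<le> (\<Sum>v\<in>UNIV. x $ (fst i, v))"
          using that by (intro member_le_sum) (auto simp: K_def)
        also have "\<dots> \<le> 1" using that by (simp add: K_def pmf_le_1)
        finally have "x $ i \<le> 1" by simp
        moreover have "0 \<le> x $ i" using that unfolding K_def by blast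
        ultimately show "\<bar>x $ i\<bar> \<le> 1" by simp
      qed
      finally show ?thesis by simp
    qed
    then show "bounded K" by (auto simp: bounded_iff)
    show "closed K"
      unfolding K_def
      by (intro closed_Collect_conj closed_Collect_all closed_Collect_le closed_Collect_eq continuous_intros)
  qed
  moreover have "continuous_on K F"
    unfolding F_def
  proof (rule continuous_on_sum)
    fix i
    show "continuous_on K (\<lambda>x. x $ i * ln (x $ i / pmf Q i))"
      by (rule continuous_on_compose2[OF continuous_on_mult_ln_divide[OF Q]])
        (auto simp: K_def simp del: split_paired_All intro!: continuous_intros)
  qed
  ultimately have "\<exists>x\<in>K. \<forall>y\<in>K. F x \<le> F y"
    by (intro continuous_attains_inf)
  then obtain x where x: "x \<in> K" and min: "\<And>y. y \<in> K \<Longrightarrow> F x \<le> F y"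
    by blast
  from x obtain \<pi> where \<pi>: "\<pi> \<in> couplings p q" "pmf \<pi> = ($) x"
    using ex_coupling[of "($) x" p q] unfolding K_def by blast
  then have "relent \<pi> Q = F x" by (simp add: F_def relent_def)
  with min vec have "relent \<pi> Q \<le> relent \<pi>' Q" if "\<pi>' \<in> couplings p q" for \<pi>'
    using that by metis
  with \<pi>(1) show ?thesis by blast
qed

section \<open>Support and product form of the minimiser\<close>

lemma mult_ln_divide_convex:
  fixes x y c t :: real
  assumes "0 \<le> x" "0 \<le> y" "0 < c" "0 < t" "t < 1"
  shows "((1 - t) * x + t * y) * ln (((1 - t) * x + t * y) / c)
    \<le> (1 - t) * (x * ln (x / c)) + t * (y * ln (y / c))"
proof (cases "(1 - t) * x + t * y = 0")
  case True
  then have "(1 - t) * x = 0" "t * y = 0" using assms by (auto simp: add_nonneg_eq_0_iff)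
  with assms show ?thesis by simp
next
  case False
  define m where "m = (1 - t) * x + t * y"
  have m: "0 < m" using False assms by (simp add: m_def order_less_le)
  \<comment> \<open>Tangent line at the mixture \<open>m\<close>. Averaged over \<open>x\<close> and
    \<open>y\<close>, the corrections \<open>m - z\<close> cancel.\<close>
  have tangent: "z * ln (m / c) \<le> z * ln (z / c) + (m - z)" if "0 \<le> z" for z
  proof (cases "z = 0")
    case False
    with that have z: "0 < z" by simp
    have "z * ln (m / z) \<le> z * (m / z - 1)" using z m by (intro mult_left_mono ln_le_minus_one) auto
    with z m assms show ?thesis by (simp add: ln_div algebra_simps)
  qed (use m in simp)
  have "m * ln (m / c) = (1 - t) * (x * ln (m / c)) + t * (y * ln (m / c))"
    by (simp add: m_def algebra_simps)
  also have "\<dots> \<le> (1 - t) * (x * ln (x / c) + (m - x)) + t * (y * ln (y / c) + (m - y))"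
    using assms by (intro add_mono mult_left_mono tangent) auto
  also have "\<dots> = (1 - t) * (x * ln (x / c)) + t * (y * ln (y / c))"
    by (simp add: m_def algebra_simps)
  finally show ?thesis by (simp add: m_def)
qed

text \<open>Mixing in a little of \<open>p \<otimes> q\<close> changes the divergence by \<open>O(t)\<close>, except that each cell where \<open>\<pi>\<close> vanishes
  contributes a term of order \<open>t ln t\<close>.\<close>
lemma I_projection_pos:
  fixes Q :: "('u::finite \<times> 'v::finite) pmf"
  assumes Q: "\<And>i. 0 < pmf Q i" and \<pi>: "\<pi> \<in> couplings p q"
    and min: "\<And>\<pi>'. \<pi>' \<in> couplings p q \<Longrightarrow> relent \<pi> Q \<le> relent \<pi>' Q"
    and u: "0 < pmf p u" and v: "0 < pmf q v"
  shows "0 < pmf \<pi> (u, v)"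
proof (rule ccontr)
  assume "\<not> ?thesis"
  then have 0: "pmf \<pi> (u, v) = 0" using pmf_nonneg[of \<pi> "(u, v)"] by linarith
  let ?\<rho> = "pair_pmf p q"
  define r where "r = pmf ?\<rho> (u, v)"
  have r: "0 < r" using u v by (simp add: r_def pmf_pair)
  define D R where "D = relent \<pi> Q" and "R = relent ?\<rho> Q"
  \<comment> \<open>Makes \<open>r * ln t\<close> equal to \<open>- (\<bar>R - D\<bar> + 1)\<close>,
    so that the gain at the empty cell outweighs the linear change \<open>R - D\<close>.\<close>
  define t where "t = exp (- ((\<bar>R - D\<bar> + 1) / r))"
  have t: "0 < t" "t < 1" using r by (auto simp: t_def)
  define x where "x i = (1 - t) * pmf \<pi> i + t * pmf ?\<rho> i" for i
  let ?h = "\<lambda>z i. z i * ln (z i / pmf Q i)"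
  have "\<exists>\<pi>'\<in>couplings p q. pmf \<pi>' = x"
  proof (rule ex_coupling)
    show "0 \<le> x i" for i using t by (simp add: x_def)
    show "(\<Sum>v\<in>UNIV. x (u, v)) = pmf p u" for u
      using \<pi> pair_pmf_in_couplings[of p q]
      by (simp add: x_def sum.distrib mem_couplings_iff flip: sum_distrib_left) (simp add: algebra_simps)
    show "(\<Sum>u\<in>UNIV. x (u, v)) = pmf q v" for v
      using \<pi> pair_pmf_in_couplings[of p q]
      by (simp add: x_def sum.distrib mem_couplings_iff flip: sum_distrib_left) (simp add: algebra_simps)
  qed
  with min have "D \<le> (\<Sum>i\<in>UNIV. ?h x i)" by (auto simp: relent_def D_def)
  also have "\<dots> = ?h x (u, v) + (\<Sum>i\<in>UNIV - {(u, v)}. ?h x i)"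
    by (intro sum.remove) auto
  \<comment> \<open>At the empty cell the mixture has mass \<open>t * r\<close>, which gives the
    decisive term \<open>t * r * ln t\<close>; convexity bounds the other cells.\<close>
  also have "?h x (u, v) = t * r * ln t + t * ?h (pmf ?\<rho>) (u, v)"
  proof -
    have "x (u, v) = t * r" by (simp add: x_def 0 r_def)
    then show ?thesis
      using t r Q[of "(u, v)"] unfolding r_def[symmetric] by (simp add: ln_mult ln_div algebra_simps)
  qed
  also have "(\<Sum>i\<in>UNIV - {(u, v)}. ?h x i)
      \<le> (\<Sum>i\<in>UNIV - {(u, v)}. (1 - t) * ?h (pmf \<pi>) i + t * ?h (pmf ?\<rho>) i)"
    unfolding x_def using Q t by (intro sum_mono mult_ln_divide_convex) auto
  also have "t * r * ln t + t * ?h (pmf ?\<rho>) (u, v)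
      + (\<Sum>i\<in>UNIV - {(u, v)}. (1 - t) * ?h (pmf \<pi>) i + t * ?h (pmf ?\<rho>) i)
      = t * r * ln t + (\<Sum>i\<in>UNIV. (1 - t) * ?h (pmf \<pi>) i + t * ?h (pmf ?\<rho>) i)"
    by (subst (2) sum.remove[of _ "(u, v)"]) (auto simp: 0)
  also have "\<dots> = t * r * ln t + ((1 - t) * D + t * R)"
    by (simp add: D_def R_def relent_def sum.distrib flip: sum_distrib_left)
  finally have "0 \<le> t * (r * ln t + R - D)" by (simp add: algebra_simps)
  then have "0 \<le> r * ln t + R - D" using t by (simp add: zero_le_mult_iff)
  then show False using r by (simp add: t_def)
qed

text \<open>First-order optimality: moving mass between the two diagonals of a rectangle keeps both
  marginals. The corners have positive mass, so both directions are admissible and the derivative of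
  the divergence is zero.\<close>

lemma I_projection_rectangle:
  fixes Q :: "('u::finite \<times> 'v::finite) pmf"
  assumes Q: "\<And>i. 0 < pmf Q i" and \<pi>: "\<pi> \<in> couplings p q"
    and min: "\<And>\<pi>'. \<pi>' \<in> couplings p q \<Longrightarrow> relent \<pi> Q \<le> relent \<pi>' Q"
    and u: "0 < pmf p u0" "0 < pmf p u1" and v: "0 < pmf q v0" "0 < pmf q v1"
  shows "ln (pmf \<pi> (u0, v0) / pmf Q (u0, v0)) + ln (pmf \<pi> (u1, v1) / pmf Q (u1, v1))
       = ln (pmf \<pi> (u0, v1) / pmf Q (u0, v1)) + ln (pmf \<pi> (u1, v0) / pmf Q (u1, v0))"
proof -
  \<comment> \<open>The direction \<open>r\<close> is a product of two differences of indicators.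
    Each sums to 0, hence so do all rows and columns; for a degenerate rectangle \<open>r\<close> is
    0.\<close>
  define a :: "'u \<Rightarrow> real" where "a i = (if i = u0 then 1 else 0) - (if i = u1 then 1 else 0)" for i
  define b :: "'v \<Rightarrow> real" where "b i = (if i = v0 then 1 else 0) - (if i = v1 then 1 else 0)" for i
  define r where "r i = a (fst i) * b (snd i)" for i
  have sa: "(\<Sum>i\<in>UNIV. a i * c i) = c u0 - c u1" for c
    by (simp add: a_def left_diff_distrib sum_subtractf if_distrib[of "\<lambda>x. x * _"] cong: if_cong)
  have sb: "(\<Sum>i\<in>UNIV. b i * c i) = c v0 - c v1" for c
    by (simp add: b_def left_diff_distrib sum_subtractf if_distrib[of "\<lambda>x. x * _"] cong: if_cong)
  have r1: "\<bar>r i\<bar> \<le> 1" for i by (auto simp: r_def a_def b_def)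
  have pos: "0 < pmf \<pi> i" if "r i \<noteq> 0" for i
  proof -
    have "fst i \<in> {u0, u1}" "snd i \<in> {v0, v1}"
      using that by (auto simp: r_def a_def b_def split: if_splits)
    then show ?thesis
      using I_projection_pos[OF Q \<pi> min, of "fst i" "snd i"] u v by auto
  qed
  define \<phi> where "\<phi> t = (\<Sum>i\<in>UNIV. (pmf \<pi> i + t * r i) * ln ((pmf \<pi> i + t * r i) / pmf Q i))" for t
  have "DERIV \<phi> 0 :> (\<Sum>i\<in>UNIV. r i * (ln (pmf \<pi> i / pmf Q i) + 1))"
    unfolding \<phi>_def
  proof (rule DERIV_sum)
    fix i
    show "DERIV (\<lambda>t. (pmf \<pi> i + t * r i) * ln ((pmf \<pi> i + t * r i) / pmf Q i)) 0
        :> r i * (ln (pmf \<pi> i / pmf Q i) + 1)"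
    proof (cases "r i = 0")
      case False
      then show ?thesis
        using pos[of i] Q[of i] by (auto intro!: derivative_eq_intros simp: field_simps)
    qed simp
  qed
  \<comment> \<open>The smallest positive mass: since \<open>r\<close> is bounded by 1,
    perturbations with \<open>\<bar>t\<bar> < d\<close> stay nonnegative.\<close>
  moreover define d where "d = Min (pmf \<pi> ` set_pmf \<pi>)"
  have fin: "finite (pmf \<pi> ` set_pmf \<pi>)" by simp
  have "0 < d"
    unfolding d_def using fin by (subst Min_gr_iff) (auto simp: set_pmf_not_empty pmf_positive)
  moreover have "\<forall>t. \<bar>0 - t\<bar> < d \<longrightarrow> \<phi> 0 \<le> \<phi> t"
  proof (intro allI impI)
    fix t assume t: "\<bar>0 - t\<bar> < d"
    have "\<exists>\<pi>'\<in>couplings p q. pmf \<pi>' = (\<lambda>i. pmf \<pi> i + t * r i)"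
    proof (rule ex_coupling)
      show "0 \<le> pmf \<pi> i + t * r i" for i
      proof (cases "r i = 0")
        case False
        then have "d \<le> pmf \<pi> i"
          unfolding d_def using pos[of i] fin by (intro Min_le) (auto simp: set_pmf_iff)
        moreover have "\<bar>t * r i\<bar> \<le> \<bar>t\<bar>" using r1[of i] by (simp add: abs_mult mult_left_le)
        ultimately show ?thesis using t by linarith
      qed simp
      show "(\<Sum>v\<in>UNIV. pmf \<pi> (u, v) + t * r (u, v)) = pmf p u" for u
        using \<pi> sb[of "\<lambda>_. 1"] by (simp add: sum.distrib mem_couplings_iff r_def flip: sum_distrib_left)
      show "(\<Sum>u\<in>UNIV. pmf \<pi> (u, v) + t * r (u, v)) = pmf q v" for v
        using \<pi> sa[of "\<lambda>_. 1"]
        by (simp add: sum.distrib mem_couplings_iff r_def flip: sum_distrib_left sum_distrib_right)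
    qed
    then obtain \<pi>' where "\<pi>' \<in> couplings p q" "pmf \<pi>' = (\<lambda>i. pmf \<pi> i + t * r i)" by blast
    with min[of \<pi>'] show "\<phi> 0 \<le> \<phi> t" by (simp add: \<phi>_def relent_def)
  qed
  ultimately have "0 = (\<Sum>i\<in>UNIV. r i * (ln (pmf \<pi> i / pmf Q i) + 1))"
    by (intro DERIV_local_min[of \<phi> _ 0 d, symmetric])
  also have "\<dots> = (\<Sum>u\<in>UNIV. a u * (\<Sum>v\<in>UNIV. b v * (ln (pmf \<pi> (u, v) / pmf Q (u, v)) + 1)))"
    by (simp add: sum_UNIV_prod r_def sum_distrib_left mult.assoc)
  finally show ?thesis by (simp add: sa sb)
qed

text \<open>By the rectangle identity the log-density is a sum of a function of \<open>u\<close> and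
  a function of \<open>v\<close> on the product of the marginal supports, and \<open>\<pi>\<close>
  vanishes elsewhere.\<close>

lemma I_projection_factorises:
  fixes Q :: "('u::finite \<times> 'v::finite) pmf"
  assumes Q: "\<And>i. 0 < pmf Q i" and \<pi>: "\<pi> \<in> couplings p q"
    and min: "\<And>\<pi>'. \<pi>' \<in> couplings p q \<Longrightarrow> relent \<pi> Q \<le> relent \<pi>' Q"
  obtains A B where "\<And>u. 0 \<le> A u" "\<And>u. 0 < pmf p u \<Longrightarrow> 0 < A u"
    "\<And>v. 0 \<le> B v" "\<And>v. 0 < pmf q v \<Longrightarrow> 0 < B v"
    "\<And>u v. pmf \<pi> (u, v) = pmf Q (u, v) * (A u * B v)"
    "relent \<pi> Q = (\<Sum>u\<in>UNIV. pmf p u * ln (A u)) + (\<Sum>v\<in>UNIV. pmf q v * ln (B v))"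
proof -
  obtain u0 where u0: "0 < pmf p u0" by (metis pmf_positive set_pmf_not_empty ex_in_conv)
  obtain v0 where v0: "0 < pmf q v0" by (metis pmf_positive set_pmf_not_empty ex_in_conv)
  define l where "l u v = ln (pmf \<pi> (u, v) / pmf Q (u, v))" for u v
  \<comment> \<open>\<open>A\<close> reads the log-density along the column \<open>v0\<close> and
    \<open>B\<close> along the row \<open>u0\<close>; subtracting \<open>l u0 v0\<close> avoids
    counting the corner twice. Off the supports both are 0, as is \<open>\<pi>\<close>.\<close>
  define A where "A u = (if 0 < pmf p u then exp (l u v0) else 0)" for u
  define B where "B v = (if 0 < pmf q v then exp (l u0 v - l u0 v0) else 0)" for v
  have marg: "map_pmf fst \<pi> = p" "map_pmf snd \<pi> = q" using \<pi> by (auto simp: couplings_def)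
  have supp: "0 < pmf p u \<and> 0 < pmf q v" if "0 < pmf \<pi> (u, v)" for u v
  proof -
    have "(u, v) \<in> set_pmf \<pi>" using that by (simp add: set_pmf_iff)
    then have "u \<in> set_pmf p" "v \<in> set_pmf q" by (force simp flip: marg)+
    then show ?thesis by (simp add: pmf_positive)
  qed
  have fac: "pmf \<pi> (u, v) = pmf Q (u, v) * (A u * B v)" for u v
  proof (cases "0 < pmf p u \<and> 0 < pmf q v")
    case True
    then have "0 < pmf \<pi> (u, v)" using I_projection_pos[OF Q \<pi> min] by blast
    then have "pmf \<pi> (u, v) = pmf Q (u, v) * exp (l u v)" using Q[of "(u, v)"] by (simp add: l_def)
    also have "l u v = l u v0 + (l u0 v - l u0 v0)"
      using I_projection_rectangle[OF Q \<pi> min, of u0 u v0 v] True u0 v0 by (simp add: l_def)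
    finally show ?thesis using True by (simp add: A_def B_def flip: exp_add)
  next
    case False
    then have "pmf \<pi> (u, v) = 0" using supp[of u v] pmf_nonneg[of \<pi> "(u, v)"] by linarith
    with False show ?thesis by (auto simp: A_def B_def)
  qed
  have "relent \<pi> Q = (\<Sum>i\<in>UNIV. pmf \<pi> i * ln (A (fst i)) + pmf \<pi> i * ln (B (snd i)))"
    unfolding relent_def
  proof (intro sum.cong refl)
    fix i
    show "pmf \<pi> i * ln (pmf \<pi> i / pmf Q i) = pmf \<pi> i * ln (A (fst i)) + pmf \<pi> i * ln (B (snd i))"
    proof (cases "pmf \<pi> i = 0")
      case False
      then have "0 < pmf \<pi> (fst i, snd i)" by (simp add: pmf_pos)
      from supp[OF this] have "0 < A (fst i)" "0 < B (snd i)" by (auto simp: A_def B_def)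
      moreover have "pmf \<pi> i / pmf Q i = A (fst i) * B (snd i)"
        using fac[of "fst i" "snd i"] Q[of i] by (simp add: field_simps)
      ultimately show ?thesis by (simp add: ln_mult algebra_simps)
    qed simp
  qed
  also have "\<dots> = (\<Sum>u\<in>UNIV. pmf p u * ln (A u)) + (\<Sum>v\<in>UNIV. pmf q v * ln (B v))"
    by (simp add: sum.distrib sum_map_pmf flip: marg)
  finally show ?thesis
    using fac by (intro that[of A B]) (auto simp: A_def B_def)
qed

section \<open>The Stein exponent\<close>

text \<open>Exponents strictly below \<open>D\<close> suffice for the supremum. When no positive
  exponent is achievable, \<open>D\<close> must be 0, in accordance with the convention for the
  empty set.\<close>

lemma stein_exponent_eqI:
  assumes "0 \<le> D" and ge: "\<And>\<theta>. 0 < \<theta> \<Longrightarrow> \<theta> < D \<Longrightarrow> achievable b P Q \<Gamma> k \<epsilon> \<theta>"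
    and le: "\<And>\<theta>. achievable b P Q \<Gamma> k \<epsilon> \<theta> \<Longrightarrow> \<theta> \<le> D"
  shows "stein_exponent b P Q \<Gamma> k \<epsilon> = ereal D"
proof -
  define A where "A = {\<theta> :: real. \<theta> > 0 \<and> achievable b P Q \<Gamma> k \<epsilon> \<theta>}"
  show ?thesis
  proof (cases "A = {}")
    case True
    then have "\<not> 0 < D" using ge[of "D / 2"] by (auto simp: A_def)
    with True \<open>0 \<le> D\<close> show ?thesis by (simp add: stein_exponent_def flip: A_def)
  next
    case False
    then have "0 < D" using le by (force simp: A_def)
    have "(SUP \<theta>\<in>A. ereal \<theta>) = ereal D"
    proof (rule antisym)
      show "(SUP \<theta>\<in>A. ereal \<theta>) \<le> ereal D"
        using le by (intro SUP_least) (auto simp: A_def)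
      show "ereal D \<le> (SUP \<theta>\<in>A. ereal \<theta>)"
      proof (rule dense_le)
        fix z assume z: "z < ereal D"
        have "max z 0 < ereal D" using z \<open>0 < D\<close> by simp
        then obtain \<theta> where \<theta>: "max z 0 < ereal \<theta>" "ereal \<theta> < ereal D"
          using ereal_dense2 by blast
        then have "\<theta> \<in> A" using ge[of \<theta>] by (simp add: A_def)
        then have "ereal \<theta> \<le> (SUP \<theta>\<in>A. ereal \<theta>)" by (rule SUP_upper)
        moreover have "z \<le> ereal \<theta>" using \<theta> by (simp add: less_imp_le)
        ultimately show "z \<le> (SUP \<theta>\<in>A. ereal \<theta>)" by (rule order_trans[rotated])
      qed
    qed
    with False show ?thesis by (simp add: stein_exponent_def flip: A_def)
  qed
qed

text \<open>The law that keeps the conditional law of U given V from \<open>Q\<close> and takes the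
  V-marginal of \<open>P\<close>: its density relative to \<open>Q\<close> depends on
  \<open>v\<close> alone, so no divergence beyond that of the marginals arises.\<close>

lemma ex_relent_eq_relent_snd:
  fixes P Q :: "('u::finite \<times> 'v::finite) pmf"
  assumes Q: "\<And>u v. 0 < pmf Q (u, v)" and Qs: "\<And>v. 0 < pmf (map_pmf snd Q) v"
  shows "\<exists>\<pi>. map_pmf snd \<pi> = map_pmf snd P \<and> relent \<pi> Q = relent (map_pmf snd P) (map_pmf snd Q)"
proof -
  define x where "x i = pmf Q i * (pmf (map_pmf snd P) (snd i) / pmf (map_pmf snd Q) (snd i))" for i
  have col: "(\<Sum>u\<in>UNIV. x (u, v)) = pmf (map_pmf snd P) v" for v
  proof -
    have "(\<Sum>u\<in>UNIV. x (u, v)) = pmf (map_pmf snd Q) v * (pmf (map_pmf snd P) v / pmf (map_pmf snd Q) v)"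
      by (simp only: x_def snd_conv pmf_map_snd[of Q] sum_distrib_right)
    then show ?thesis using Qs[of v] by simp
  qed
  have "sum x UNIV = (\<Sum>v\<in>UNIV. \<Sum>u\<in>UNIV. x (u, v))"
    unfolding sum_UNIV_prod by (rule sum.swap)
  then have "sum x UNIV = 1" by (simp add: col sum_pmf_UNIV)
  moreover have "0 \<le> x i" for i by (simp add: x_def)
  ultimately obtain \<pi> where \<pi>: "pmf \<pi> = x" using ex_pmf by blast
  then have snd: "map_pmf snd \<pi> = map_pmf snd P"
    by (intro pmf_eqI) (simp add: pmf_map_snd[of \<pi>] col)
  have "relent \<pi> Q = (\<Sum>i\<in>UNIV. pmf \<pi> i * ln (pmf (map_pmf snd P) (snd i) / pmf (map_pmf snd Q) (snd i)))"
    unfolding relent_def using Q by (intro sum.cong) (auto simp: \<pi> x_def less_imp_neq[THEN not_sym])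
  also have "\<dots> = relent (map_pmf snd P) (map_pmf snd Q)"
    unfolding relent_def snd[symmetric] by (simp only: sum_map_pmf)
  finally show ?thesis using snd by blast
qed

theorem theorem1:
  fixes P Q :: "('u :: finite \<times> 'v :: finite) pmf"
    and \<Gamma> :: "'x :: finite \<Rightarrow> 'y :: finite pmf"
    and k :: "nat \<Rightarrow> nat"
    and \<epsilon> b :: real
  assumes "1 < b"
    and "\<And>u v. 0 < pmf Q (u, v)"
    and "\<And>n. 1 \<le> n \<Longrightarrow> 0 < k n"
    and "filterlim k at_top sequentially"
    and "(\<lambda>n. real (k n) / real n) \<longlonglongrightarrow> 0"
    and "0 \<le> \<epsilon>" and "\<epsilon> < 1"
  shows "((\<exists>x0 x1 y. 0 < pmf (\<Gamma> x0) y \<and> pmf (\<Gamma> x1) y = 0) \<longrightarrow>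
            (\<exists>\<pi> \<in> couplings (map_pmf fst P) (map_pmf snd P).
               (\<forall>\<pi>' \<in> couplings (map_pmf fst P) (map_pmf snd P). kl b \<pi> Q \<le> kl b \<pi>' Q) \<and>
               stein_exponent b P Q \<Gamma> k \<epsilon> = ereal (kl b \<pi> Q)))
       \<and> (\<not> (\<exists>x0 x1 y. 0 < pmf (\<Gamma> x0) y \<and> pmf (\<Gamma> x1) y = 0) \<longrightarrow>
            stein_exponent b P Q \<Gamma> k \<epsilon> = ereal (kl b (map_pmf snd P) (map_pmf snd Q)))"
proof (intro conjI impI)
  note b = assms(1) and Q = assms(2) and k = assms(4,5) and \<epsilon> = assms(6,7)
  have Q': "0 < pmf Q i" for i using Q by (cases i) simp
  have lnb: "0 < ln b" using b by simp
  let ?C = "couplings (map_pmf fst P) (map_pmf snd P)"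
  assume "\<exists>x0 x1 y. 0 < pmf (\<Gamma> x0) y \<and> pmf (\<Gamma> x1) y = 0"
  then obtain x0 x1 c where x: "0 < pmf (\<Gamma> x0) c" "pmf (\<Gamma> x1) c = 0" by blast
  obtain \<pi> where \<pi>: "\<pi> \<in> ?C" and min: "\<And>\<pi>'. \<pi>' \<in> ?C \<Longrightarrow> relent \<pi> Q \<le> relent \<pi>' Q"
    using ex_I_projection[OF Q'] by blast
  have "stein_exponent b P Q \<Gamma> k \<epsilon> = ereal (relent \<pi> Q / ln b)"
  proof (rule stein_exponent_eqI)
    show "0 \<le> relent \<pi> Q / ln b" using lnb Q' by (simp add: relent_nonneg)
    show "\<theta> \<le> relent \<pi> Q / ln b" if "achievable b P Q \<Gamma> k \<epsilon> \<theta>" for \<theta>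
      \<comment> \<open>The comparison constant is 1, since \<open>\<pi>\<close> already has the
        sensor marginal of \<open>P\<close>.\<close>
      by (rule achievable_imp_le_relent[OF Q b \<epsilon>(2) k(2), of 1])
        (use \<pi> that in \<open>auto simp: couplings_def\<close>)
    show "achievable b P Q \<Gamma> k \<epsilon> \<theta>" if \<theta>: "\<theta> < relent \<pi> Q / ln b" for \<theta>
    proof -
      from I_projection_factorises[OF Q' \<pi> min] obtain A B where
        A: "\<And>u. 0 \<le> A u" "\<And>u. 0 < pmf (map_pmf fst P) u \<Longrightarrow> 0 < A u" and
        B: "\<And>v. 0 \<le> B v" "\<And>v. 0 < pmf (map_pmf snd P) v \<Longrightarrow> 0 < B v" and
        fac: "\<And>u v. pmf \<pi> (u, v) = pmf Q (u, v) * (A u * B v)" and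
        D: "relent \<pi> Q = (\<Sum>u\<in>UNIV. pmf (map_pmf fst P) u * ln (A u))
          + (\<Sum>v\<in>UNIV. pmf (map_pmf snd P) v * ln (B v))" by blast
      have "(\<Sum>(u, v)\<in>UNIV. pmf Q (u, v) * (A u * B v)) = (\<Sum>i\<in>UNIV. pmf \<pi> i)"
        by (intro sum.cong) (auto simp: fac)
      then have "(\<Sum>(u, v)\<in>UNIV. pmf Q (u, v) * (A u * B v)) \<le> 1" by (simp add: sum_pmf_UNIV)
      moreover have "\<theta> * ln b < relent \<pi> Q" using \<theta> lnb by (simp add: pos_less_divide_eq)
      ultimately show ?thesis
        using x unfolding D by (intro achievableI[OF b \<epsilon>(1) k(1) A B]) auto
    qed
  qed
  then show "\<exists>\<pi>\<in>?C. (\<forall>\<pi>'\<in>?C. kl b \<pi> Q \<le> kl b \<pi>' Q) \<and> stein_exponent b P Q \<Gamma> k \<epsilon> = ereal (kl b \<pi> Q)"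
    using \<pi> min lnb by (intro bexI[of _ \<pi>]) (simp_all add: kl_eq_relent[OF b Q'] divide_right_mono)
next
  note b = assms(1) and Q = assms(2) and k = assms(4,5) and \<epsilon> = assms(6,7)
  have lnb: "0 < ln b" using b by simp
  let ?p = "map_pmf snd P" and ?q = "map_pmf snd Q"
  have q: "0 < pmf ?q v" for v
    unfolding pmf_map_snd using Q by (intro sum_pos) auto
  assume "\<not> (\<exists>x0 x1 y. 0 < pmf (\<Gamma> x0) y \<and> pmf (\<Gamma> x1) y = 0)"
  then have same_support: "0 < pmf (\<Gamma> x') y" if "0 < pmf (\<Gamma> x) y" for x x' y
    using that by (metis pmf_pos)
  have ex_output: "\<exists>y. 0 < pmf (\<Gamma> x) y" for x
    by (metis pmf_positive set_pmf_not_empty ex_in_conv)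
  \<comment> \<open>The positive transition probabilities. As all inputs reach the same outputs, the
    minimum \<open>c\<close> of this finite set compares any two inputs.\<close>
  define V where "V = {r. \<exists>x y. r = pmf (\<Gamma> x) y \<and> 0 < r}"
  have "V \<subseteq> range (\<lambda>(x, y). pmf (\<Gamma> x) y)" by (auto simp: V_def)
  then have fin: "finite V" by (rule finite_subset) simp
  obtain r where r: "r \<in> V" using ex_output[of undefined] by (auto simp: V_def)
  define c where "c = Min V"
  have c0: "0 < c" unfolding c_def using fin r by (subst Min_gr_iff) (auto simp: V_def)
  have c: "c \<le> pmf (\<Gamma> x) y" if "0 < pmf (\<Gamma> x) y" for x y
    unfolding c_def using fin that by (intro Min_le) (auto simp: V_def)
  have "c \<le> r" unfolding c_def using fin r by (rule Min_le)
  also have "r \<le> 1" using r by (auto simp: V_def pmf_le_1)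
  finally have c1: "c \<le> 1" .
  have comparable: "c * pmf (\<Gamma> x') y \<le> pmf (\<Gamma> x) y" for x x' y
  proof (cases "pmf (\<Gamma> x') y = 0")
    case False
    then have "c * pmf (\<Gamma> x') y \<le> c" using c0 by (intro mult_left_le) (auto simp: pmf_le_1)
    moreover have "0 < pmf (\<Gamma> x') y" using False by (simp add: pmf_pos)
    then have "0 < pmf (\<Gamma> x) y" by (rule same_support)
    then have "c \<le> pmf (\<Gamma> x) y" by (rule c)
    ultimately show ?thesis by simp
  qed simp
  obtain \<pi> where \<pi>: "map_pmf snd \<pi> = ?p" "relent \<pi> Q = relent ?p ?q"
    using ex_relent_eq_relent_snd[OF Q q] by blast
  have "stein_exponent b P Q \<Gamma> k \<epsilon> = ereal (relent ?p ?q / ln b)"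
  proof (rule stein_exponent_eqI)
    show "0 \<le> relent ?p ?q / ln b" using lnb q by (simp add: relent_nonneg)
    show "\<theta> \<le> relent ?p ?q / ln b" if "achievable b P Q \<Gamma> k \<epsilon> \<theta>" for \<theta>
      using achievable_imp_le_relent[OF Q b \<epsilon>(2) k(2) c0 c1 \<pi>(1) _ that] comparable \<pi>(2) by simp
    show "achievable b P Q \<Gamma> k \<epsilon> \<theta>" if \<theta>: "\<theta> < relent ?p ?q / ln b" for \<theta>
    proof -
      \<comment> \<open>Local test at the decision center: \<open>A\<close> is 1 and
        \<open>B\<close> is the likelihood ratio of the V-marginals, which has mean 1 under
        \<open>Q\<close>.\<close>
      obtain x y where xy: "0 < pmf (\<Gamma> x) y" using ex_output by blast
      have "(\<Sum>(u, v)\<in>UNIV. pmf Q (u, v) * (1 * (pmf ?p v / pmf ?q v)))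
          = (\<Sum>i\<in>UNIV. pmf Q i * (pmf ?p (snd i) / pmf ?q (snd i)))"
        by (simp add: case_prod_beta)
      also have "\<dots> = (\<Sum>v\<in>UNIV. pmf ?q v * (pmf ?p v / pmf ?q v))"
        by (simp only: sum_map_pmf)
      also have "\<dots> = (\<Sum>v\<in>UNIV. pmf ?p v)"
        using q by (intro sum.cong) (auto simp: less_imp_neq[THEN not_sym])
      finally have "(\<Sum>(u, v)\<in>UNIV. pmf Q (u, v) * (1 * (pmf ?p v / pmf ?q v))) \<le> 1"
        by (simp only: sum_pmf_UNIV)
      moreover have "\<theta> * ln b < relent ?p ?q" using \<theta> lnb by (simp add: pos_less_divide_eq)
      ultimately show ?thesis
        using q xy by (intro achievableI[OF b \<epsilon>(1) k(1), where A = "\<lambda>_. 1" and B = "\<lambda>v. pmf ?p v / pmf ?q v"])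
          (auto simp: relent_def)
    qed
  qed
  then show "stein_exponent b P Q \<Gamma> k \<epsilon> = ereal (kl b ?p ?q)"
    by (simp add: kl_eq_relent[OF b q])
qed

end
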